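(* Let $\mathcal{A}$ be a countable structure. If $\mathcal{A}$ is not computably categorical on any cone, then there exists a Turing degree $\mathbf{e}$ such that for every degree $\mathbf{d} \geq \mathbf{e}$ and every degree $\mathbf{c}$ that is c.e. in and above $\mathbf{d}$, there exists a $\mathbf{d}$-computable copy $\mathcal{B}$ of $\mathcal{A}$ such that (1) there is a $\mathbf{c}$-computable isomorphism between $\mathcal{A}$ and $\mathcal{B}$, and (2) for every isomorphism $f$ between $\mathcal{A}$ and $\mathcal{B}$, $f \oplus \mathbf{d}$ computes $\mathbf{c}$.
   Context: $\mathcal{A}$ is computably categorical on the cone above $\mathbf{e}$ if for every degree $\mathbf{c} \geq \mathbf{e}$, any two $\mathbf{c}$-computable copies of $\mathcal{A}$ (copies with domain $\omega$ whose atomic diagram is $\mathbf{c}$-computable) have a $\mathbf{c}$-computable isomorphism between them. "Not computably categorical on any cone" means this fails for every $\mathbf{e}$. A degree $\mathbf{c}$ is c.e. in and above $\mathbf{d}$ if $\mathbf{c} \geq \mathbf{d}$ and $\mathbf{c}$ contains a set c.e. relative to $\mathbf{d}$. *)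

theory Defs
  imports Main "HOL-Library.Nat_Bijection"
begin

section \<open>Relative computability\<close>

text \<open>Descriptions of partial recursive functions with an oracle, and their call-by-value
  semantics: \<open>computes g p xs y\<close> says that \<open>p\<close> with oracle \<open>g\<close> converges on the
  argument list \<open>xs\<close> with output \<open>y\<close>. In \<open>PrimRec\<close> the recursion variable, and in
  \<open>Mu\<close> the search variable, is the first argument.\<close>

datatype prog =
    Zero
  | Succ
  | Proj nat
  | Query
  | Comp prog "prog list"
  | PrimRec prog prog
  | Mu prog

inductive computes :: "(nat \<Rightarrow> nat) \<Rightarrow> prog \<Rightarrow> nat list \<Rightarrow> nat \<Rightarrow> bool" for g where
  zero: "computes g Zero xs 0"
| succ: "computes g Succ [x] (Suc x)"
| proj: "i < length xs \<Longrightarrow> computes g (Proj i) xs (xs ! i)"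
| query: "computes g Query [x] (g x)"
| comp: "list_all2 (\<lambda>p y. computes g p xs y) ps ys \<Longrightarrow> computes g q ys z \<Longrightarrow>
    computes g (Comp q ps) xs z"
| primrec_0: "computes g p xs y \<Longrightarrow> computes g (PrimRec p q) (0 # xs) y"
| primrec_Suc: "computes g (PrimRec p q) (n # xs) y \<Longrightarrow> computes g q (n # y # xs) z \<Longrightarrow>
    computes g (PrimRec p q) (Suc n # xs) z"
| mu: "computes g p (n # xs) 0 \<Longrightarrow> \<forall>m<n. \<exists>y. computes g p (m # xs) (Suc y) \<Longrightarrow>
    computes g (Mu p) xs n"

definition turing_le :: "(nat \<Rightarrow> nat) \<Rightarrow> (nat \<Rightarrow> nat) \<Rightarrow> bool" (infix "\<le>\<^sub>T" 50) where
  "f \<le>\<^sub>T g \<longleftrightarrow> (\<exists>p. \<forall>x. computes g p [x] (f x))"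

definition turing_equiv :: "(nat \<Rightarrow> nat) \<Rightarrow> (nat \<Rightarrow> nat) \<Rightarrow> bool" (infix "\<equiv>\<^sub>T" 50) where
  "f \<equiv>\<^sub>T g \<longleftrightarrow> f \<le>\<^sub>T g \<and> g \<le>\<^sub>T f"

definition fun_join :: "(nat \<Rightarrow> nat) \<Rightarrow> (nat \<Rightarrow> nat) \<Rightarrow> nat \<Rightarrow> nat" (infixr "\<oplus>\<^sub>T" 65) where
  "(f \<oplus>\<^sub>T g) n = (if even n then f (n div 2) else g (n div 2))"

lemma turing_le_refl: "f \<le>\<^sub>T f"
  unfolding turing_le_def by (auto intro: computes.query)

primrec replace_query :: "prog \<Rightarrow> prog \<Rightarrow> prog" where
  "replace_query r Zero = Zero"
| "replace_query r Succ = Succ"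
| "replace_query r (Proj i) = Proj i"
| "replace_query r Query = r"
| "replace_query r (Comp q ps) = Comp (replace_query r q) (map (replace_query r) ps)"
| "replace_query r (PrimRec p q) = PrimRec (replace_query r p) (replace_query r q)"
| "replace_query r (Mu p) = Mu (replace_query r p)"

lemma computes_replace_query:
  assumes "computes g p xs y" and r: "\<And>x. computes h r [x] (g x)"
  shows "computes h (replace_query r p) xs y"
  using assms(1)
proof induction
  case (comp xs ps ys q z)
  from comp(1) have "list_all2 (\<lambda>p y. computes h p xs y) (map (replace_query r) ps) ys"
    by (auto simp: list_all2_map1 elim: list_all2_mono)
  with comp show ?case by (auto intro: computes.comp)
qed (auto intro: computes.intros r)

lemma turing_le_trans: "f \<le>\<^sub>T g \<Longrightarrow> g \<le>\<^sub>T h \<Longrightarrow> f \<le>\<^sub>T h"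
  unfolding turing_le_def by (blast intro: computes_replace_query)

lemma computes_Comp1:
  "computes g p xs y \<Longrightarrow> computes g q [y] z \<Longrightarrow> computes g (Comp q [p]) xs z"
  by (rule computes.comp[of _ _ _ "[y]"]) auto

lemma computes_Comp2:
  "computes g p xs y \<Longrightarrow> computes g p' xs y' \<Longrightarrow> computes g q [y, y'] z \<Longrightarrow>
    computes g (Comp q [p, p']) xs z"
  by (rule computes.comp[of _ _ _ "[y, y']"]) auto

lemma computes_Proj: "i < length xs \<Longrightarrow> y = xs ! i \<Longrightarrow> computes g (Proj i) xs y"
  by (simp add: computes.proj)

definition double_prog :: prog where
  "double_prog = PrimRec Zero (Comp Succ [Comp Succ [Proj 1]])"

lemma double_prog: "computes g double_prog [n] (2 * n)"
  unfolding double_prog_def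
proof (induction n)
  case (Suc n)
  have "computes g (Comp Succ [Comp Succ [Proj 1]]) (n # (2 * n) # []) (Suc (Suc (2 * n)))"
    by (rule computes_Comp1 computes_Proj computes.succ | simp)+
  from computes.primrec_Suc[OF Suc this] show ?case by simp
qed (auto intro: computes.intros)

definition parity_prog :: prog where
  "parity_prog = PrimRec Zero (Comp (PrimRec (Comp Succ [Zero]) Zero) [Proj 1])"

lemma parity_prog: "computes g parity_prog [n] (n mod 2)"
  unfolding parity_prog_def
proof (induction n)
  case (Suc n)
  have one: "computes g (PrimRec (Comp Succ [Zero]) Zero) [0] 1"
    by (auto intro!: computes.primrec_0 computes_Comp1 computes.zero computes.succ)
  have "computes g (PrimRec (Comp Succ [Zero]) Zero) [n mod 2] (Suc n mod 2)"
  proof (cases "even n")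
    case True
    then have "n mod 2 = 0" "Suc n mod 2 = 1" by presburger+
    then show ?thesis using one by simp
  next
    case False
    then have "n mod 2 = Suc 0" "Suc n mod 2 = 0" by presburger+
    then show ?thesis using computes.primrec_Suc[OF one computes.zero] by simp
  qed
  then have "computes g (Comp (PrimRec (Comp Succ [Zero]) Zero) [Proj 1]) (n # (n mod 2) # [])
      (Suc n mod 2)"
    by (rule computes_Comp1[rotated]) (simp add: computes_Proj)
  from computes.primrec_Suc[OF Suc this] show ?case .
qed (auto intro: computes.intros)

definition add_prog :: prog where
  "add_prog = PrimRec (Proj 0) (Comp Succ [Proj 1])"

lemma add_prog: "computes g add_prog [m, n] (m + n)"
  unfolding add_prog_def
proof (induction m)
  case 0
  show ?case by (rule computes.primrec_0) (simp add: computes_Proj)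
next
  case (Suc m)
  have "computes g (Comp Succ [Proj 1]) (m # (m + n) # [n]) (Suc (m + n))"
    by (rule computes_Comp1[OF computes_Proj computes.succ]) simp_all
  from computes.primrec_Suc[OF Suc this] show ?case by simp
qed

definition half_prog :: prog where
  "half_prog = PrimRec Zero (Comp add_prog [Comp parity_prog [Proj 0], Proj 1])"

lemma half_prog: "computes g half_prog [n] (n div 2)"
  unfolding half_prog_def
proof (induction n)
  case (Suc n)
  have eq: "n mod 2 + n div 2 = Suc n div 2" by presburger
  have "computes g (Comp add_prog [Comp parity_prog [Proj 0], Proj 1]) (n # (n div 2) # [])
      (n mod 2 + n div 2)"
    by (rule computes_Comp2[OF computes_Comp1[OF computes_Proj parity_prog] computes_Proj add_prog])
      simp_all
  from computes.primrec_Suc[OF Suc this] show ?case by (simp add: eq)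
qed (auto intro: computes.intros)

lemma fun_join_ge1: "f \<le>\<^sub>T f \<oplus>\<^sub>T g"
  unfolding turing_le_def
proof (intro exI allI)
  fix x
  have "computes (f \<oplus>\<^sub>T g) (Comp Query [double_prog]) [x] ((f \<oplus>\<^sub>T g) (2 * x))"
    by (rule computes_Comp1[OF double_prog computes.query])
  then show "computes (f \<oplus>\<^sub>T g) (Comp Query [double_prog]) [x] (f x)"
    by (simp add: fun_join_def)
qed

lemma fun_join_ge2: "g \<le>\<^sub>T f \<oplus>\<^sub>T g"
  unfolding turing_le_def
proof (intro exI allI)
  fix x
  have "computes (f \<oplus>\<^sub>T g) (Comp Query [Comp Succ [double_prog]]) [x] ((f \<oplus>\<^sub>T g) (Suc (2 * x)))"
    by (rule computes_Comp1[OF computes_Comp1[OF double_prog computes.succ] computes.query])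
  then show "computes (f \<oplus>\<^sub>T g) (Comp Query [Comp Succ [double_prog]]) [x] (g x)"
    by (simp add: fun_join_def)
qed

lemma fun_join_least:
  assumes "f \<le>\<^sub>T h" and "g \<le>\<^sub>T h"
  shows "f \<oplus>\<^sub>T g \<le>\<^sub>T h"
proof -
  from assms obtain p q where p: "\<And>x. computes h p [x] (f x)" and q: "\<And>x. computes h q [x] (g x)"
    unfolding turing_le_def by blast
  define r where "r = PrimRec (Comp p [Comp half_prog [Proj 0]]) (Comp q [Comp half_prog [Proj 2]])"
  have "computes h (Comp r [parity_prog, Proj 0]) [n] ((f \<oplus>\<^sub>T g) n)" for n
  proof -
    have 0: "computes h r [0, n] (f (n div 2))"
      unfolding r_def
      by (rule computes.primrec_0, rule computes_Comp1[OF computes_Comp1[OF computes_Proj half_prog] p])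
        simp_all
    have "computes h (Comp q [Comp half_prog [Proj 2]]) (0 # f (n div 2) # [n]) (g (n div 2))"
      by (rule computes_Comp1[OF computes_Comp1[OF computes_Proj half_prog] q]) simp_all
    then have 1: "computes h r [Suc 0, n] (g (n div 2))"
      using 0 computes.primrec_Suc unfolding r_def by blast
    have "computes h r [n mod 2, n] ((f \<oplus>\<^sub>T g) n)"
    proof (cases "even n")
      case True
      then have "n mod 2 = 0" by presburger
      with True 0 show ?thesis by (simp add: fun_join_def)
    next
      case False
      then have "n mod 2 = Suc 0" by presburger
      with False 1 show ?thesis by (simp add: fun_join_def)
    qed
    then show ?thesis
      by (rule computes_Comp2[OF parity_prog computes_Proj, rotated -1]) simp_all
  qed
  then show ?thesis unfolding turing_le_def by blast
qed

section \<open>Turing degrees\<close>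

text \<open>Degrees are formed from total functions on the natural numbers; a set is represented by
  its characteristic function.\<close>

quotient_type degree = "nat \<Rightarrow> nat" / turing_equiv
  unfolding turing_equiv_def
  by (intro equivpI reflpI sympI transpI) (blast intro: turing_le_refl turing_le_trans)+

lift_definition degree_of :: "(nat \<Rightarrow> nat) \<Rightarrow> degree" is "\<lambda>f. f" .

instantiation degree :: semilattice_sup
begin

lift_definition less_eq_degree :: "degree \<Rightarrow> degree \<Rightarrow> bool" is turing_le
  unfolding turing_equiv_def by (blast intro: turing_le_trans)

definition less_degree :: "degree \<Rightarrow> degree \<Rightarrow> bool" where
  "less_degree c d \<longleftrightarrow> c \<le> d \<and> \<not> d \<le> c"

lift_definition sup_degree :: "degree \<Rightarrow> degree \<Rightarrow> degree" is fun_join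
  unfolding turing_equiv_def
  by (blast intro: fun_join_least fun_join_ge1 fun_join_ge2 turing_le_trans)

instance
proof
  fix a b c :: degree
  show "a < b \<longleftrightarrow> a \<le> b \<and> \<not> b \<le> a" by (rule less_degree_def)
  show "a \<le> a" by transfer (rule turing_le_refl)
  show "a \<le> b \<Longrightarrow> b \<le> c \<Longrightarrow> a \<le> c" by transfer (rule turing_le_trans)
  show "a \<le> b \<Longrightarrow> b \<le> a \<Longrightarrow> a = b" by transfer (simp add: turing_equiv_def)
  show "a \<le> sup a b" by transfer (rule fun_join_ge1)
  show "b \<le> sup a b" by transfer (rule fun_join_ge2)
  show "b \<le> a \<Longrightarrow> c \<le> a \<Longrightarrow> sup b c \<le> a" by transfer (rule fun_join_least)
qed

end

definition char_fun :: "nat set \<Rightarrow> nat \<Rightarrow> nat" where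
  "char_fun X n = (if n \<in> X then 1 else 0)"

definition ce_in :: "nat set \<Rightarrow> degree \<Rightarrow> bool" where
  "ce_in X d \<longleftrightarrow> X = {} \<or> (\<exists>f. degree_of f \<le> d \<and> X = range f)"

definition ce_in_and_above :: "degree \<Rightarrow> degree \<Rightarrow> bool" where
  "ce_in_and_above c d \<longleftrightarrow> d \<le> c \<and> (\<exists>X. degree_of (char_fun X) = c \<and> ce_in X d)"

section \<open>Countable structures and their atomic diagrams\<close>

text \<open>Symbols of a countable language are natural numbers; \<open>None\<close> means that the number is not
  a symbol, and constants are \<open>0\<close>-ary function symbols. The universe is an arbitrary subset of
  the natural numbers. Interpretations of non-symbols and values on tuples of the wrong
  length or outside the universe are never consulted.\<close>

record language =
  rel_arity :: "nat \<Rightarrow> nat option"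
  fun_arity :: "nat \<Rightarrow> nat option"

record model =
  universe :: "nat set"
  rel_interp :: "nat \<Rightarrow> nat list \<Rightarrow> bool"
  fun_interp :: "nat \<Rightarrow> nat list \<Rightarrow> nat"

definition tuples :: "model \<Rightarrow> nat \<Rightarrow> nat list set" where
  "tuples A n = {xs. length xs = n \<and> set xs \<subseteq> universe A}"

definition is_structure :: "language \<Rightarrow> model \<Rightarrow> bool" where
  "is_structure L A \<longleftrightarrow>
    (\<forall>s n. fun_arity L s = Some n \<longrightarrow> (\<forall>xs\<in>tuples A n. fun_interp A s xs \<in> universe A))"

text \<open>An isomorphism is given as a total function; only its values on \<open>universe A\<close>
  matter. If \<open>universe A\<close> is computable from the degrees under consideration, it makes no
  difference for computability whether the map or an arbitrary total extension of it is used: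
  the former is computable iff some extension is, and it computes a set iff every extension
  does.\<close>

definition is_iso :: "language \<Rightarrow> model \<Rightarrow> model \<Rightarrow> (nat \<Rightarrow> nat) \<Rightarrow> bool" where
  "is_iso L A B f \<longleftrightarrow>
    bij_betw f (universe A) (universe B) \<and>
    (\<forall>s n. rel_arity L s = Some n \<longrightarrow>
      (\<forall>xs\<in>tuples A n. rel_interp A s xs \<longleftrightarrow> rel_interp B s (map f xs))) \<and>
    (\<forall>s n. fun_arity L s = Some n \<longrightarrow>
      (\<forall>xs\<in>tuples A n. f (fun_interp A s xs) = fun_interp B s (map f xs)))"

text \<open>Closed terms and atomic sentences in the language expanded by a name \<open>Elem a\<close> for
  each element \<open>a\<close>.\<close>

datatype trm = Elem nat | App nat "trm list"

datatype atom = Eq trm trm | Rel nat "trm list"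

primrec wf_trm :: "language \<Rightarrow> model \<Rightarrow> trm \<Rightarrow> bool" where
  "wf_trm L A (Elem a) \<longleftrightarrow> a \<in> universe A"
| "wf_trm L A (App s ts) \<longleftrightarrow> fun_arity L s = Some (length ts) \<and> list_all (wf_trm L A) ts"

primrec wf_atom :: "language \<Rightarrow> model \<Rightarrow> atom \<Rightarrow> bool" where
  "wf_atom L A (Eq t u) \<longleftrightarrow> wf_trm L A t \<and> wf_trm L A u"
| "wf_atom L A (Rel s ts) \<longleftrightarrow> rel_arity L s = Some (length ts) \<and> list_all (wf_trm L A) ts"

primrec trm_val :: "model \<Rightarrow> trm \<Rightarrow> nat" where
  "trm_val A (Elem a) = a"
| "trm_val A (App s ts) = fun_interp A s (map (trm_val A) ts)"

primrec holds :: "model \<Rightarrow> atom \<Rightarrow> bool" where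
  "holds A (Eq t u) \<longleftrightarrow> trm_val A t = trm_val A u"
| "holds A (Rel s ts) \<longleftrightarrow> rel_interp A s (map (trm_val A) ts)"

primrec trm_number :: "trm \<Rightarrow> nat" where
  "trm_number (Elem a) = sum_encode (Inl a)"
| "trm_number (App s ts) = sum_encode (Inr (prod_encode (s, list_encode (map trm_number ts))))"

primrec atom_number :: "atom \<Rightarrow> nat" where
  "atom_number (Eq t u) = sum_encode (Inl (prod_encode (trm_number t, trm_number u)))"
| "atom_number (Rel s ts) = sum_encode (Inr (prod_encode (s, list_encode (map trm_number ts))))"

text \<open>Goedel numbers of the atomic (\<open>Inl\<close>) and negated atomic (\<open>Inr\<close>) sentences
  true in the structure.\<close>

definition atomic_diagram :: "language \<Rightarrow> model \<Rightarrow> nat set" where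
  "atomic_diagram L A =
    {sum_encode (Inl (atom_number \<phi>)) | \<phi>. wf_atom L A \<phi> \<and> holds A \<phi>} \<union>
    {sum_encode (Inr (atom_number \<phi>)) | \<phi>. wf_atom L A \<phi> \<and> \<not> holds A \<phi>}"

definition computable_copy :: "language \<Rightarrow> model \<Rightarrow> degree \<Rightarrow> model \<Rightarrow> bool" where
  "computable_copy L A c B \<longleftrightarrow>
    is_structure L B \<and> universe B = UNIV \<and> (\<exists>f. is_iso L A B f) \<and>
    degree_of (char_fun (atomic_diagram L B)) \<le> c"

definition comp_categorical_on_cone :: "language \<Rightarrow> model \<Rightarrow> degree \<Rightarrow> bool" where
  "comp_categorical_on_cone L A e \<longleftrightarrow>
    (\<forall>c\<ge>e. \<forall>B B'. computable_copy L A c B \<longrightarrow> computable_copy L A c B' \<longrightarrow>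
      (\<exists>f. is_iso L B B' f \<and> degree_of f \<le> c))"

end

theory Submission
  imports Defs "HOL-Library.Countable" "HOL-Library.Sublist"
begin

text \<open>Every function that depends only on the structure, however noncomputable, may be put into the
  degree \<open>e\<close>. Hence the only computations that need programs are pairing, primitive recursion and
  unbounded search; all tests on finite data come for free from the oracle.

  Fix a copy \<open>M\<close> with universe \<open>UNIV\<close>. A tuple \<open>zs\<close> is free over its first \<open>r\<close> entries if every finite
  part of the diagram of every extension of \<open>zs\<close> is also realised, with the same first \<open>r\<close> entries,
  by a tuple whose initial part is not automorphic to \<open>zs\<close>. If some tuple has no free extension over
  it, then finite parts of diagrams determine orbits over that tuple, and a back-and-forth search
  builds isomorphisms between any two copies: the structure is categorical on a cone. Otherwise, let
  \<open>C\<close> be c.e. in \<open>d\<close>. Build the copy as a growing chain of blocks, block \<open>i\<close> being free over the previous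
  one, and when \<open>i\<close> enters \<open>C\<close> move block \<open>i\<close> to a different orbit without changing the diagram
  decided so far. The set \<open>C\<close> tells when a block is final, so it computes the limit isomorphism.
  Conversely, any isomorphism shows whether block \<open>i\<close> at some stage lies in its final orbit, and if it
  does, then no number up to \<open>i\<close> can enter \<open>C\<close> later.\<close>

section \<open>Closure properties of relative computability\<close>

lemma turing_le_compose:
  assumes "f \<le>\<^sub>T h" and "g \<le>\<^sub>T h"
  shows "(\<lambda>x. f (g x)) \<le>\<^sub>T h"
  using assms unfolding turing_le_def by (blast intro: computes_Comp1)

lemma turing_le_const: "(\<lambda>x. k) \<le>\<^sub>T h"
proof (induction k)
  case 0
  show ?case unfolding turing_le_def by (blast intro: computes.zero)
next
  case (Suc k)
  then show ?case unfolding turing_le_def by (blast intro: computes_Comp1 computes.succ)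
qed

lemma turing_le_Suc: "Suc \<le>\<^sub>T h"
  unfolding turing_le_def by (blast intro: computes.succ)

lemma turing_le_id: "(\<lambda>x. x) \<le>\<^sub>T h"
  unfolding turing_le_def by (rule exI[of _ "Proj 0"]) (simp add: computes_Proj)

section \<open>Programs for pairing, recursion and search with an oracle\<close>

definition triangle_prog :: prog where
  "triangle_prog = PrimRec Zero (Comp add_prog [Proj 1, Comp Succ [Proj 0]])"

lemma triangle_prog: "computes g triangle_prog [n] (triangle n)"
  unfolding triangle_prog_def
proof (induction n)
  case 0
  then show ?case by (auto intro: computes.intros)
next
  case (Suc n)
  have "computes g (Comp add_prog [Proj 1, Comp Succ [Proj 0]]) (n # triangle n # [])
      (triangle n + Suc n)"
    by (rule computes_Comp2[OF computes_Proj computes_Comp1[OF computes_Proj computes.succ] add_prog])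
      simp_all
  from computes.primrec_Suc[OF Suc this] show ?case by simp
qed

definition pair_prog :: prog where
  "pair_prog = Comp add_prog [Comp triangle_prog [add_prog], Proj 0]"

lemma pair_prog: "computes g pair_prog [m, n] (prod_encode (m, n))"
  unfolding pair_prog_def prod_encode_def
  by (simp, rule computes_Comp2[OF computes_Comp1[OF add_prog triangle_prog] computes_Proj add_prog])
    simp_all

lemma computes_pair:
  "computes g p xs y \<Longrightarrow> computes g q xs z \<Longrightarrow>
    computes g (Comp pair_prog [p, q]) xs (prod_encode (y, z))"
  by (rule computes_Comp2[OF _ _ pair_prog])

lemma turing_le_pair:
  assumes "f \<le>\<^sub>T h" and "g \<le>\<^sub>T h"
  shows "(\<lambda>x. prod_encode (f x, g x)) \<le>\<^sub>T h"
  using assms unfolding turing_le_def by (blast intro: computes_pair)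

text \<open>The initial value is one number, so a constant program supplies it no matter how it was
  obtained; only the passage from one value to the next has to be computed.\<close>

lemma turing_le_primrec:
  assumes "t \<le>\<^sub>T h" and "g \<le>\<^sub>T h"
    and rec: "\<And>n. st (Suc n) = t (prod_encode (st n, g n))"
  shows "st \<le>\<^sub>T h"
proof -
  from assms obtain p q where p: "\<And>x. computes h p [x] (t x)" and q: "\<And>x. computes h q [x] (g x)"
    unfolding turing_le_def by blast
  obtain z where z: "\<And>x. computes h z [x] (st 0)"
    using turing_le_const[of "st 0" h] unfolding turing_le_def by blast
  let ?step = "Comp p [Comp pair_prog [Proj 1, Comp q [Proj 0]]]"
  let ?r = "PrimRec (Comp z [Zero]) ?step"
  have "computes h ?r [n] (st n)" for n
  proof (induction n)
    case 0
    show ?case by (rule computes.primrec_0, rule computes_Comp1[OF computes.zero z])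
  next
    case (Suc n)
    have "computes h ?step (n # st n # []) (t (prod_encode (st n, g n)))"
      by (rule computes_Comp1[OF computes_pair[OF computes_Proj computes_Comp1[OF computes_Proj q]] p])
        simp_all
    from computes.primrec_Suc[OF Suc this] show ?case by (simp add: rec)
  qed
  then show ?thesis unfolding turing_le_def by blast
qed

text \<open>The reversal puts the newest value at the head, so passing from \<open>n\<close> to
  \<open>Suc n\<close> costs one pairing and one successor of the list code.\<close>

definition hist :: "(nat \<Rightarrow> nat) \<Rightarrow> nat \<Rightarrow> nat" where
  "hist f n = list_encode (rev (map f [0..<n]))"

lemma rev_list_decode_hist [simp]: "rev (list_decode (hist f n)) = map f [0..<n]"
  by (simp add: hist_def)

lemma length_list_decode_hist [simp]: "length (list_decode (hist f n)) = n"
  by (simp add: hist_def)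

lemma turing_le_hist:
  assumes "f \<le>\<^sub>T h"
  shows "hist f \<le>\<^sub>T h"
proof -
  obtain p where p: "\<And>x. computes h p [x] (f x)" using assms unfolding turing_le_def by blast
  let ?step = "Comp Succ [Comp pair_prog [Comp p [Proj 0], Proj 1]]"
  have "computes h (PrimRec Zero ?step) [n] (hist f n)" for n
  proof (induction n)
    case 0
    show ?case by (auto simp: hist_def intro: computes.intros)
  next
    case (Suc n)
    have "computes h ?step (n # hist f n # []) (Suc (prod_encode (f n, hist f n)))"
      by (rule computes_Comp1[OF computes_pair[OF computes_Comp1[OF computes_Proj p] computes_Proj]
            computes.succ]) simp_all
    from computes.primrec_Suc[OF Suc this] show ?case by (simp add: hist_def)
  qed
  then show ?thesis unfolding turing_le_def by blast
qed

definition least_stage :: "(nat \<Rightarrow> nat) \<Rightarrow> (nat \<Rightarrow> nat) \<Rightarrow> nat \<Rightarrow> nat" where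
  "least_stage D P i = (LEAST s. P (prod_encode (D s, i)) = 0)"

lemma least_stage:
  assumes "\<exists>s. P (prod_encode (D s, i)) = 0"
  shows "P (prod_encode (D (least_stage D P i), i)) = 0"
  unfolding least_stage_def using assms by (rule LeastI_ex)

text \<open>The program is claimed to halt only where the search succeeds. In a recursion whose step
  is a search, success is known just for the states that really occur, so a total search function
  would be too much to ask.\<close>

lemma search_prog:
  assumes "D \<le>\<^sub>T h" and "P \<le>\<^sub>T h" and "t \<le>\<^sub>T h"
  obtains r where "\<And>i. \<exists>s. P (prod_encode (D s, i)) = 0 \<Longrightarrow>
    computes h r [i] (t (prod_encode (D (least_stage D P i), i)))"
proof -
  from assms obtain d p q where d: "\<And>x. computes h d [x] (D x)"
    and p: "\<And>x. computes h p [x] (P x)" and q: "\<And>x. computes h q [x] (t x)"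
    unfolding turing_le_def by blast
  let ?c = "Comp p [Comp pair_prog [Comp d [Proj 0], Proj 1]]"
  let ?m = "Mu ?c"
  have c: "computes h ?c [s, i] (P (prod_encode (D s, i)))" for s i
    by (rule computes_Comp1[OF computes_pair[OF computes_Comp1[OF computes_Proj d] computes_Proj] p])
      simp_all
  show thesis
  proof (rule that)
    fix i assume ex: "\<exists>s. P (prod_encode (D s, i)) = 0"
    have "computes h ?m [i] (least_stage D P i)"
    proof (rule computes.mu)
      show "computes h ?c [least_stage D P i, i] 0"
        using c[of "least_stage D P i" i] least_stage[OF ex] by simp
      show "\<forall>m<least_stage D P i. \<exists>y. computes h ?c [m, i] (Suc y)"
      proof (intro allI impI)
        fix m assume "m < least_stage D P i"
        then have "P (prod_encode (D m, i)) \<noteq> 0"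
          unfolding least_stage_def by (rule not_less_Least)
        then obtain y where "P (prod_encode (D m, i)) = Suc y" by (cases "P (prod_encode (D m, i))") auto
        then show "\<exists>y. computes h ?c [m, i] (Suc y)" using c[of m i] by auto
      qed
    qed
    then show "computes h (Comp q [Comp pair_prog [Comp d [?m], Proj 0]]) [i]
        (t (prod_encode (D (least_stage D P i), i)))"
      by (intro computes_Comp1[OF computes_pair[OF computes_Comp1[OF _ d] computes_Proj] q]) simp_all
  qed
qed

lemma turing_le_search:
  assumes "D \<le>\<^sub>T h" and "P \<le>\<^sub>T h" and "t \<le>\<^sub>T h"
    and "\<And>i. \<exists>s. P (prod_encode (D s, i)) = 0"
  shows "(\<lambda>i. t (prod_encode (D (least_stage D P i), i))) \<le>\<^sub>T h"
  using search_prog[OF assms(1-3)] assms(4) unfolding turing_le_def by metis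

lemma turing_le_primrec_search:
  assumes "D \<le>\<^sub>T h" and "P \<le>\<^sub>T h" and "t \<le>\<^sub>T h"
    and ex: "\<And>n. \<exists>s. P (prod_encode (D s, prod_encode (st n, n))) = 0"
    and rec: "\<And>n. st (Suc n) =
      t (prod_encode (D (least_stage D P (prod_encode (st n, n))), prod_encode (st n, n)))"
  shows "st \<le>\<^sub>T h"
proof -
  obtain r where r: "\<And>i. \<exists>s. P (prod_encode (D s, i)) = 0 \<Longrightarrow>
      computes h r [i] (t (prod_encode (D (least_stage D P i), i)))"
    using search_prog[OF assms(1-3)] by blast
  obtain z where z: "\<And>x. computes h z [x] (st 0)"
    using turing_le_const[of "st 0" h] unfolding turing_le_def by blast
  let ?step = "Comp r [Comp pair_prog [Proj 1, Proj 0]]"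
  have "computes h (PrimRec (Comp z [Zero]) ?step) [n] (st n)" for n
  proof (induction n)
    case 0
    show ?case by (rule computes.primrec_0, rule computes_Comp1[OF computes.zero z])
  next
    case (Suc n)
    have "computes h ?step (n # st n # []) (st (Suc n))"
      unfolding rec
      by (rule computes_Comp1[OF computes_pair[OF computes_Proj computes_Proj] r[OF ex]]) simp_all
    from computes.primrec_Suc[OF Suc this] show ?case .
  qed
  then show ?thesis unfolding turing_le_def by blast
qed

lemma degree_of_le_iff: "degree_of f \<le> degree_of g \<longleftrightarrow> f \<le>\<^sub>T g"
  by transfer simp

lemma degree_of_surj: obtains f where "d = degree_of f"
proof -
  have "\<exists>f. d = degree_of f" by transfer (meson turing_equiv_def turing_le_refl)
  then show thesis using that by blast
qed

section \<open>Isomorphisms and renamings of literals\<close>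

lemma is_iso_compose:
  assumes f: "is_iso L A B f" and g: "is_iso L B C g"
  shows "is_iso L A C (g \<circ> f)"
proof -
  have t: "map f xs \<in> tuples B n" if "xs \<in> tuples A n" for xs n
    using that f by (fastforce simp: tuples_def is_iso_def bij_betw_def)
  show ?thesis
    unfolding is_iso_def
  proof (intro conjI allI impI ballI)
    show "bij_betw (g \<circ> f) (universe A) (universe C)"
      using f g unfolding is_iso_def by (blast intro: bij_betw_trans)
  next
    fix s n xs assume "rel_arity L s = Some n" "xs \<in> tuples A n"
    then show "rel_interp A s xs \<longleftrightarrow> rel_interp C s (map (g \<circ> f) xs)"
      using f g t[of xs n] unfolding is_iso_def map_map[symmetric] by blast
  next
    fix s n xs assume "fun_arity L s = Some n" "xs \<in> tuples A n"
    then show "(g \<circ> f) (fun_interp A s xs) = fun_interp C s (map (g \<circ> f) xs)"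
      using f g t[of xs n] unfolding is_iso_def map_map[symmetric] comp_apply by metis
  qed
qed

text \<open>Closure of \<open>A\<close> under its functions matters here: the inverse undoes
  \<open>f\<close> only on \<open>universe A\<close>, so function values must lie there.\<close>

lemma is_iso_inv_into:
  assumes A: "is_structure L A" and f: "is_iso L A B f"
  shows "is_iso L B A (inv_into (universe A) f)"
proof -
  let ?g = "inv_into (universe A) f"
  have bij: "bij_betw f (universe A) (universe B)" using f by (simp add: is_iso_def)
  have t: "map ?g xs \<in> tuples A n \<and> map f (map ?g xs) = xs" if "xs \<in> tuples B n" for xs n
  proof
    have mem: "x \<in> f ` universe A" if "x \<in> set xs" for x
      using \<open>xs \<in> tuples B n\<close> that bij by (auto simp: tuples_def bij_betw_def)
    then show "map ?g xs \<in> tuples A n"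
      using that by (auto simp: tuples_def intro!: inv_into_into)
    show "map f (map ?g xs) = xs"
      using mem by (simp add: map_idI f_inv_into_f)
  qed
  show ?thesis
    unfolding is_iso_def
  proof (intro conjI allI impI ballI)
    show "bij_betw ?g (universe B) (universe A)" using bij by (rule bij_betw_inv_into)
  next
    fix s n xs assume "rel_arity L s = Some n" "xs \<in> tuples B n"
    then show "rel_interp B s xs \<longleftrightarrow> rel_interp A s (map ?g xs)"
      using f t[of xs n] unfolding is_iso_def by metis
  next
    fix s n xs assume s: "fun_arity L s = Some n" and xs: "xs \<in> tuples B n"
    have "f (fun_interp A s (map ?g xs)) = fun_interp B s xs"
      using f t[OF xs] s unfolding is_iso_def by metis
    moreover have "fun_interp A s (map ?g xs) \<in> universe A"
      using A s t[OF xs] unfolding is_structure_def by blast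
    ultimately show "?g (fun_interp B s xs) = fun_interp A s (map ?g xs)"
      using bij by (metis bij_betw_inv_into_left)
  qed
qed

section \<open>Renaming of names in literals, and diagrams pulled back along a map\<close>

primrec ren_trm :: "(nat \<Rightarrow> nat) \<Rightarrow> trm \<Rightarrow> trm" where
  "ren_trm F (Elem a) = Elem (F a)"
| "ren_trm F (App s ts) = App s (map (ren_trm F) ts)"

primrec ren_atom :: "(nat \<Rightarrow> nat) \<Rightarrow> atom \<Rightarrow> atom" where
  "ren_atom F (Eq t u) = Eq (ren_trm F t) (ren_trm F u)"
| "ren_atom F (Rel s ts) = Rel s (map (ren_trm F) ts)"

type_synonym lit = "bool \<times> atom"

definition ren_lit :: "(nat \<Rightarrow> nat) \<Rightarrow> lit \<Rightarrow> lit" where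
  "ren_lit F l = (fst l, ren_atom F (snd l))"

definition lit_number :: "lit \<Rightarrow> nat" where
  "lit_number l = sum_encode ((if fst l then Inl else Inr) (atom_number (snd l)))"

definition lit_true :: "language \<Rightarrow> model \<Rightarrow> lit \<Rightarrow> bool" where
  "lit_true L A l \<longleftrightarrow> wf_atom L A (snd l) \<and> holds A (snd l) = fst l"

text \<open>When \<open>universe A = UNIV\<close> and \<open>F\<close> is a permutation of the
  natural numbers, this is the atomic diagram of the structure pulled back along \<open>F\<close>.
  For \<open>F = (!) xs\<close> it is the diagram of the tuple \<open>xs\<close>, with positions
  serving as names.\<close>

definition pulled_diagram :: "language \<Rightarrow> model \<Rightarrow> (nat \<Rightarrow> nat) \<Rightarrow> nat set" where
  "pulled_diagram L A F = {lit_number l | l. lit_true L A (ren_lit F l)}"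

lemma atomic_diagram_alt: "atomic_diagram L A = {lit_number l | l. lit_true L A l}"
proof -
  have "(\<exists>l. n = lit_number l \<and> lit_true L A l) \<longleftrightarrow>
      (\<exists>\<phi>. n = lit_number (True, \<phi>) \<and> lit_true L A (True, \<phi>)) \<or>
      (\<exists>\<phi>. n = lit_number (False, \<phi>) \<and> lit_true L A (False, \<phi>))" for n
    by (metis (full_types) surj_pair)
  then show ?thesis
    by (auto simp: atomic_diagram_def lit_number_def lit_true_def)
qed

section \<open>Injectivity of Goedel numbers, and their bound on the names in a sentence\<close>

lemma trm_number_inj: "trm_number t = trm_number u \<Longrightarrow> t = u"
proof (induction t arbitrary: u)
  case (Elem a)
  then show ?case by (cases u) (auto simp: sum_encode_eq)
next
  case (App s ts)
  then obtain us where u: "u = App s us" and eq: "map trm_number ts = map trm_number us"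
    by (cases u) (auto simp: sum_encode_eq prod_encode_eq list_encode_eq)
  have "ts = us"
    using eq App.IH by (metis (mono_tags, lifting) list.inj_map_strong)
  with u show ?case by simp
qed

lemma inj_trm_number: "inj trm_number"
  by (auto intro: injI trm_number_inj)

lemma atom_number_inj: "atom_number \<phi> = atom_number \<psi> \<Longrightarrow> \<phi> = \<psi>"
  by (cases \<phi>; cases \<psi>)
    (auto simp: sum_encode_eq prod_encode_eq list_encode_eq trm_number_inj
      dest: inj_map_eq_map[OF inj_trm_number, THEN iffD1])

lemma inj_lit_number: "inj lit_number"
  by (rule injI) (auto simp: lit_number_def sum_encode_eq prod_eq_iff atom_number_inj split: if_splits)

lemma member_le_list_encode: "x \<in> set xs \<Longrightarrow> x \<le> list_encode xs"
proof (induction xs)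
  case (Cons y ys)
  have "y \<le> prod_encode (y, list_encode ys)" "list_encode ys \<le> prod_encode (y, list_encode ys)"
    by (rule le_prod_encode_1 le_prod_encode_2)+
  with Cons show ?case by auto
qed simp

lemma le_sum_encode: "x \<le> sum_encode (Inl x)" "x \<le> sum_encode (Inr x)"
  by (auto simp: sum_encode_def)

lemma member_le_trm_number_App:
  "t \<in> set ts \<Longrightarrow> trm_number t \<le> prod_encode (s, list_encode (map trm_number ts))"
  by (rule le_trans[OF member_le_list_encode le_prod_encode_2]) simp

text \<open>A name is at most the number of every term containing it, because the encodings of sums,
  pairs and lists never fall below their arguments.\<close>

lemma ren_trm_cong: "(\<And>a. a \<le> trm_number t \<Longrightarrow> F a = G a) \<Longrightarrow> ren_trm F t = ren_trm G t"
proof (induction t)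
  case (Elem a)
  then show ?case using le_sum_encode(1)[of a] by simp
next
  case (App s ts)
  have "ren_trm F t = ren_trm G t" if "t \<in> set ts" for t
  proof (rule App.IH[OF that])
    fix a assume "a \<le> trm_number t"
    also have "\<dots> \<le> trm_number (App s ts)"
      using le_trans[OF member_le_trm_number_App[OF that] le_sum_encode(2)] by simp
    finally show "F a = G a" by (rule App.prems)
  qed
  then show ?case by simp
qed

lemma ren_atom_cong:
  assumes "\<And>a. a \<le> atom_number \<phi> \<Longrightarrow> F a = G a"
  shows "ren_atom F \<phi> = ren_atom G \<phi>"
proof (cases \<phi>)
  case (Eq t u)
  have "trm_number t \<le> atom_number \<phi>" "trm_number u \<le> atom_number \<phi>"
    using Eq le_prod_encode_1[of "trm_number t" "trm_number u"]
      le_prod_encode_2[of "trm_number u" "trm_number t"]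
      le_sum_encode(1)[of "prod_encode (trm_number t, trm_number u)"] by auto
  then have "ren_trm F t = ren_trm G t" "ren_trm F u = ren_trm G u"
    using assms by (auto intro!: ren_trm_cong)
  with Eq show ?thesis by simp
next
  case (Rel s ts)
  have "ren_trm F t = ren_trm G t" if "t \<in> set ts" for t
  proof (rule ren_trm_cong)
    fix a assume "a \<le> trm_number t"
    also have "\<dots> \<le> atom_number \<phi>"
      using Rel le_trans[OF member_le_trm_number_App[OF that] le_sum_encode(2)] by simp
    finally show "F a = G a" by (rule assms)
  qed
  with Rel show ?thesis by simp
qed

text \<open>A use principle: a literal with number \<open>n\<close> mentions no name above
  \<open>n\<close>. Hence a tuple with more than \<open>n\<close> entries already decides
  \<open>n\<close>.\<close>

lemma pulled_diagram_cong:
  assumes "\<And>a. a \<le> n \<Longrightarrow> F a = G a"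
  shows "n \<in> pulled_diagram L A F \<longleftrightarrow> n \<in> pulled_diagram L A G"
proof -
  have "ren_lit F l = ren_lit G l" if "n = lit_number l" for l
  proof -
    have "atom_number (snd l) \<le> n" using that le_sum_encode by (simp add: lit_number_def)
    then show ?thesis using assms by (auto simp: ren_lit_def intro!: ren_atom_cong)
  qed
  then show ?thesis by (auto simp: pulled_diagram_def) metis+
qed

section \<open>Diagrams under isomorphisms\<close>

lemma ren_trm_comp: "ren_trm F (ren_trm G t) = ren_trm (F \<circ> G) t"
  by (induction t) auto

lemma ren_lit_comp: "ren_lit F (ren_lit G l) = ren_lit (F \<circ> G) l"
  by (cases l; cases "snd l") (auto simp: ren_lit_def ren_trm_comp)

lemma wf_ren_trm:
  assumes "universe A = UNIV" and "universe B = UNIV"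
  shows "wf_trm L B (ren_trm F t) \<longleftrightarrow> wf_trm L A t"
  using assms by (induction t) (auto simp: list_all_iff)

lemma wf_ren_atom:
  assumes "universe A = UNIV" and "universe B = UNIV"
  shows "wf_atom L B (ren_atom F \<phi>) \<longleftrightarrow> wf_atom L A \<phi>"
  using assms by (cases \<phi>) (auto simp: list_all_iff wf_ren_trm[OF assms])

lemma trm_val_ren:
  assumes "universe A = UNIV" and "is_iso L A B f" and "wf_trm L A t"
  shows "trm_val B (ren_trm f t) = f (trm_val A t)"
  using assms(3)
proof (induction t)
  case (App s ts)
  then have "map (trm_val B \<circ> ren_trm f) ts = map f (map (trm_val A) ts)"
    by (auto simp: list_all_iff)
  moreover have "f (fun_interp A s (map (trm_val A) ts)) = fun_interp B s (map f (map (trm_val A) ts))"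
    using App.prems assms(1,2) by (simp add: is_iso_def tuples_def)
  ultimately show ?case by (simp only: trm_val.simps ren_trm.simps map_map)
qed simp

lemma lit_true_ren:
  assumes A: "universe A = UNIV" and B: "universe B = UNIV" and f: "is_iso L A B f"
  shows "lit_true L B (ren_lit f l) \<longleftrightarrow> lit_true L A l"
proof (cases "wf_atom L A (snd l)")
  case wf: True
  have "holds B (ren_atom f (snd l)) \<longleftrightarrow> holds A (snd l)"
  proof (cases "snd l")
    case (Eq t u)
    have "inj f" using A f by (simp add: is_iso_def bij_betw_def)
    with wf Eq show ?thesis by (simp add: trm_val_ren[OF A f] inj_eq)
  next
    case (Rel s ts)
    then have "map (trm_val B \<circ> ren_trm f) ts = map f (map (trm_val A) ts)"
      using wf by (auto simp: list_all_iff trm_val_ren[OF A f])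
    moreover have "rel_interp A s (map (trm_val A) ts) \<longleftrightarrow> rel_interp B s (map f (map (trm_val A) ts))"
      using wf Rel A f by (simp add: is_iso_def tuples_def)
    ultimately show ?thesis using Rel by (simp only: holds.simps ren_atom.simps map_map)
  qed
  then show ?thesis using wf by (simp add: lit_true_def ren_lit_def wf_ren_atom[OF A B])
next
  case False
  then show ?thesis by (simp add: lit_true_def ren_lit_def wf_ren_atom[OF A B])
qed

lemma pulled_diagram_iso:
  assumes "universe A = UNIV" and "universe B = UNIV" and "is_iso L A B f"
  shows "pulled_diagram L B (f \<circ> F) = pulled_diagram L A F"
  by (simp add: pulled_diagram_def lit_true_ren[OF assms] flip: ren_lit_comp)

lemma pulled_diagram_id: "pulled_diagram L A (\<lambda>x. x) = atomic_diagram L A"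
proof -
  have "ren_trm (\<lambda>x. x) t = t" for t by (induction t) (auto simp: map_idI)
  then have "ren_atom (\<lambda>x. x) \<phi> = \<phi>" for \<phi> by (cases \<phi>) (auto simp: map_idI)
  then show ?thesis by (simp add: pulled_diagram_def atomic_diagram_alt ren_lit_def)
qed

lemma char_diagram_iff:
  "char_fun (atomic_diagram L B) (lit_number l) = 1 \<longleftrightarrow> lit_true L B l"
proof -
  have "lit_number l \<in> atomic_diagram L B \<longleftrightarrow> lit_true L B l"
    unfolding atomic_diagram_alt mem_Collect_eq using injD[OF inj_lit_number] by metis
  then show ?thesis by (simp add: char_fun_def)
qed

lemma pulled_diagram_lit: "lit_number l \<in> pulled_diagram L B F \<longleftrightarrow> lit_true L B (ren_lit F l)"
  unfolding pulled_diagram_def mem_Collect_eq using injD[OF inj_lit_number] by metis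

section \<open>Approximate agreement and orbits of tuples\<close>

text \<open>The length plays two roles: it bounds the literal numbers compared, and by the use
  principle it guarantees that these literals read only actual entries, never values of
  \<open>!\<close> past the end.\<close>

definition agree :: "language \<Rightarrow> model \<Rightarrow> nat list \<Rightarrow> model \<Rightarrow> nat list \<Rightarrow> bool" where
  "agree L A xs B ys \<longleftrightarrow> length xs = length ys \<and>
    (\<forall>n<length xs. n \<in> pulled_diagram L A ((!) xs) \<longleftrightarrow> n \<in> pulled_diagram L B ((!) ys))"

lemma agree_trans: "agree L A xs B ys \<Longrightarrow> agree L B ys C zs \<Longrightarrow> agree L A xs C zs"
  by (simp add: agree_def)

lemma agree_iso:
  assumes "universe A = UNIV" and "universe B = UNIV" and "is_iso L A B f"
  shows "agree L A xs B (map f xs)"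
proof -
  have "n \<in> pulled_diagram L B ((!) (map f xs)) \<longleftrightarrow> n \<in> pulled_diagram L B (f \<circ> (!) xs)"
    if "n < length xs" for n
    using that by (intro pulled_diagram_cong) simp
  then show ?thesis by (simp add: agree_def pulled_diagram_iso[OF assms])
qed

definition same_orbit :: "language \<Rightarrow> model \<Rightarrow> nat list \<Rightarrow> nat list \<Rightarrow> bool" where
  "same_orbit L A xs ys \<longleftrightarrow> (\<exists>f. is_iso L A A f \<and> map f xs = ys)"

lemma same_orbit_take: "same_orbit L A xs ys \<Longrightarrow> same_orbit L A (take k xs) (take k ys)"
  by (auto simp: same_orbit_def take_map)

lemma same_orbit_trans:
  "same_orbit L A xs ys \<Longrightarrow> same_orbit L A ys zs \<Longrightarrow> same_orbit L A xs zs"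
  unfolding same_orbit_def by (metis is_iso_compose map_map)

definition free_over :: "language \<Rightarrow> model \<Rightarrow> nat \<Rightarrow> nat list \<Rightarrow> bool" where
  "free_over L A r zs \<longleftrightarrow> (\<forall>xs. distinct xs \<longrightarrow> prefix zs xs \<longrightarrow>
    (\<exists>xs'. distinct xs' \<and> agree L A xs A xs' \<and> take r xs' = take r xs \<and>
      \<not> same_orbit L A zs (take (length zs) xs')))"

definition dense_free :: "language \<Rightarrow> model \<Rightarrow> bool" where
  "dense_free L A \<longleftrightarrow>
    (\<forall>xs. distinct xs \<longrightarrow> (\<exists>zs. prefix xs zs \<and> distinct zs \<and> free_over L A (length xs) zs))"

lemma free_over_mono:
  assumes "free_over L A r zs" and "r' \<le> r"
  shows "free_over L A r' zs"
  unfolding free_over_def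
proof (intro allI impI)
  fix xs assume "distinct xs" "prefix zs xs"
  then obtain xs' where "distinct xs' \<and> agree L A xs A xs' \<and> take r xs' = take r xs \<and>
      \<not> same_orbit L A zs (take (length zs) xs')"
    using assms(1) unfolding free_over_def by blast
  moreover from this have "take r' xs' = take r' xs"
    using assms(2) by (metis min.absorb1 take_take)
  ultimately show "\<exists>xs'. distinct xs' \<and> agree L A xs A xs' \<and> take r' xs' = take r' xs \<and>
      \<not> same_orbit L A zs (take (length zs) xs')" by blast
qed

section \<open>Few free tuples give categoricity on a cone\<close>

text \<open>Injectivity and each instance of preservation involve finitely many elements, so
  agreement with some isomorphism on every initial segment suffices for them. Surjectivity is not of
  this kind and is assumed separately.\<close>

lemma is_iso_local:
  assumes univ: "universe A = UNIV" "universe B = UNIV"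
    and loc: "\<And>N. \<exists>k. is_iso L A B k \<and> (\<forall>x<N. f x = k x)"
    and "surj f"
  shows "is_iso L A B f"
proof -
  have cover: "\<exists>k. is_iso L A B k \<and> (\<forall>x\<in>insert y (set xs). f x = k x)" for y xs
  proof -
    obtain N where "\<forall>x\<in>insert y (set xs). x < N"
      by (meson finite_insert finite_nat_set_iff_bounded finite_set)
    then show ?thesis using loc[of N] by blast
  qed
  show ?thesis
    unfolding is_iso_def
  proof (intro conjI allI impI ballI)
    have "inj f"
    proof (rule injI)
      fix x y assume eq: "f x = f y"
      obtain k where k: "is_iso L A B k" "\<forall>z\<in>insert x (set [y]). f z = k z" using cover by blast
      then have "inj k" using univ by (simp add: is_iso_def bij_betw_def)
      with k(2) eq show "x = y" by (metis injD insertI1 insertI2 list.set_intros(1))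
    qed
    then show "bij_betw f (universe A) (universe B)" using univ \<open>surj f\<close> by (simp add: bij_betw_def)
  next
    fix s n xs assume "rel_arity L s = Some n" "xs \<in> tuples A n"
    moreover obtain k where k: "is_iso L A B k" "\<forall>x\<in>insert 0 (set xs). f x = k x" using cover by blast
    moreover have "map f xs = map k xs" using k by simp
    ultimately show "rel_interp A s xs \<longleftrightarrow> rel_interp B s (map f xs)" unfolding is_iso_def by metis
  next
    fix s n xs assume "fun_arity L s = Some n" "xs \<in> tuples A n"
    moreover obtain k where k: "is_iso L A B k" "\<forall>x\<in>insert (fun_interp A s xs) (set xs). f x = k x"
      using cover by blast
    moreover have "map f xs = map k xs" using k by simp
    ultimately show "f (fun_interp A s xs) = fun_interp B s (map f xs)"
      unfolding is_iso_def by (metis insertI1)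
  qed
qed

section \<open>Partial isomorphisms over a tuple with no free extension\<close>

locale few_free =
  fixes L :: language and M :: model and cs :: "nat list"
  assumes M: "is_structure L M" and univ: "universe M = UNIV" and cs: "distinct cs"
    and few: "\<And>zs. prefix cs zs \<Longrightarrow> distinct zs \<Longrightarrow> \<not> free_over L M (length cs) zs"
begin

text \<open>This is the failure of \<open>free_over\<close> at a single extension \<open>xs\<close>
  of \<open>zs\<close>: among tuples beginning with \<open>cs\<close>, the part of the diagram of
  \<open>xs\<close> below its length already fixes the orbit of \<open>zs\<close>.\<close>

definition pins :: "nat list \<Rightarrow> nat list \<Rightarrow> bool" where
  "pins zs xs \<longleftrightarrow> distinct xs \<and> prefix zs xs \<and>
    (\<forall>xs'. distinct xs' \<longrightarrow> agree L M xs M xs' \<longrightarrow> take (length cs) xs' = cs \<longrightarrow>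
      same_orbit L M zs (take (length zs) xs'))"

definition witness :: "nat list \<Rightarrow> nat list" where
  "witness zs = (SOME xs. pins zs xs)"

lemma witness:
  assumes "prefix cs zs" and "distinct zs"
  shows "pins zs (witness zs)"
proof -
  from few[OF assms] obtain xs where xs: "distinct xs" "prefix zs xs"
    and *: "\<And>xs'. distinct xs' \<Longrightarrow> agree L M xs M xs' \<Longrightarrow> take (length cs) xs' = take (length cs) xs \<Longrightarrow>
      same_orbit L M zs (take (length zs) xs')"
    unfolding free_over_def by blast
  have "take (length cs) xs = cs" using xs(2) assms(1) by (auto simp: prefix_def)
  then have "pins zs xs" using xs * unfolding pins_def by simp
  then show ?thesis unfolding witness_def by (rule someI)
qed

text \<open>The list \<open>ds\<close> is a finite part of the characteristic function of an atomic diagram.\<close>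

definition extension ::
    "nat list \<times> nat list \<Rightarrow> nat \<Rightarrow> nat list \<Rightarrow> nat list \<times> nat list \<Rightarrow> bool" where
  "extension q n ds e \<longleftrightarrow> (let (zs, ys) = q; (zs', us) = e in
    prefix zs zs' \<and> distinct zs' \<and> n \<in> set zs' \<and>
    prefix ys us \<and> distinct us \<and> n \<in> set (take (length zs') us) \<and>
    length us = length (witness zs') \<and>
    (\<forall>l. lit_number l < length us \<longrightarrow> lit_number (ren_lit ((!) us) l) < length ds \<and>
      (lit_true L M (ren_lit ((!) (witness zs')) l) \<longleftrightarrow> ds ! lit_number (ren_lit ((!) us) l) = 1)))"

text \<open>Success is coded by 0, the value for which \<open>Mu\<close> searches.\<close>

definition search_test :: "nat \<Rightarrow> nat" where
  "search_test w = (let (a, i) = prod_decode w; (q, n) = prod_decode i in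
    if \<exists>e. extension (from_nat q) n (rev (list_decode a)) e then 0 else 1)"

text \<open>The entries of \<open>us\<close> beyond \<open>length zs\<close> only certify that the
  orbit is pinned, so they are dropped.\<close>

definition search_next :: "nat \<Rightarrow> nat" where
  "search_next w = (let (a, i) = prod_decode w; (q, n) = prod_decode i;
    (zs, us) = (SOME e. extension (from_nat q) n (rev (list_decode a)) e)
    in to_nat (zs, take (length zs) us))"

text \<open>The invariant of the search. The isomorphism \<open>k\<close> may change from one stage
  to the next; only its existence is carried along.\<close>

definition good :: "model \<Rightarrow> nat list \<times> nat list \<Rightarrow> bool" where
  "good B q \<longleftrightarrow> prefix cs (fst q) \<and> distinct (fst q) \<and>
    (\<exists>k. is_iso L M B k \<and> snd q = map k (fst q))"

lemma extension_agree:
  assumes "extension q n (map (char_fun (atomic_diagram L B)) [0..<s]) (zs', us)"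
  shows "agree L M (witness zs') B us"
proof -
  have len: "length us = length (witness zs')"
    and "\<And>l. lit_number l < length us \<Longrightarrow>
      lit_true L M (ren_lit ((!) (witness zs')) l) \<longleftrightarrow> lit_true L B (ren_lit ((!) us) l)"
    using assms by (auto simp: extension_def char_diagram_iff[unfolded One_nat_def] split: prod.splits)
  then have "lit_number l < length us \<Longrightarrow> lit_number l \<in> pulled_diagram L M ((!) (witness zs')) \<longleftrightarrow>
      lit_number l \<in> pulled_diagram L B ((!) us)" for l
    by (simp add: pulled_diagram_lit)
  \<comment> \<open>Numbers that code no literal lie in no pulled diagram, so comparing literals
    settles every \<open>n\<close>.\<close>
  moreover have "n \<notin> pulled_diagram L C F" if "n \<notin> range lit_number" for n C F
    using that by (auto simp: pulled_diagram_def)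
  ultimately show ?thesis using len unfolding agree_def by (metis rangeE)
qed

text \<open>Move \<open>us\<close> back to \<open>M\<close> along the inverse of \<open>k\<close>.
  The result begins with \<open>cs\<close> and agrees with the witness, so pinning yields an
  automorphism \<open>a\<close> of \<open>M\<close> carrying \<open>zs'\<close> to its first part.
  Then \<open>k \<circ> a\<close> is the new isomorphism.\<close>

lemma good_extension:
  assumes B: "universe B = UNIV" and q: "good B q"
    and ext: "extension q n (map (char_fun (atomic_diagram L B)) [0..<s]) (zs', us)"
  shows "good B (zs', take (length zs') us)"
proof -
  obtain zs ys where q_def: "q = (zs, ys)" by (cases q)
  obtain k where k: "is_iso L M B k" and ys: "ys = map k zs" and zs: "prefix cs zs" "distinct zs"
    using q by (auto simp: good_def q_def)
  have zs': "prefix zs zs'" "distinct zs'" and us: "prefix ys us" "distinct us"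
    using ext by (auto simp: extension_def q_def)
  have cs_zs': "prefix cs zs'" using zs zs' by auto
  define g where "g = inv_into (universe M) k"
  have g: "is_iso L B M g" unfolding g_def by (rule is_iso_inv_into[OF M k])
  have bij: "bij k" using k univ B by (simp add: is_iso_def)
  have gk: "g (k x) = x" and kg: "k (g x) = x" for x
    using bij univ by (simp_all add: g_def bij_is_inj bij_is_surj surj_f_inv_f)
  have "pins zs' (witness zs')" by (rule witness[OF cs_zs' zs'(2)])
  moreover have "distinct (map g us)"
    using us(2) kg by (metis distinct_map inj_on_inverseI)
  moreover have "agree L M (witness zs') M (map g us)"
    using agree_trans[OF extension_agree[OF ext] agree_iso[OF B univ g]] .
  moreover have "take (length cs) (map g us) = cs"
    using us(1) zs(1) by (auto simp: ys prefix_def comp_def gk)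
  ultimately have "same_orbit L M zs' (take (length zs') (map g us))"
    unfolding pins_def by blast
  then obtain a where a: "is_iso L M M a" "map a zs' = take (length zs') (map g us)"
    unfolding same_orbit_def by blast
  have "map (k \<circ> a) zs' = map k (take (length zs') (map g us))" by (simp flip: a(2))
  also have "\<dots> = take (length zs') us" by (simp add: take_map comp_def kg)
  finally show ?thesis
    using is_iso_compose[OF a(1) k] cs_zs' zs'(2) by (auto simp: good_def)
qed

text \<open>The isomorphism \<open>k\<close> itself supplies an answer: enlarge \<open>zs\<close> by
  \<open>n\<close> and by the preimage of \<open>n\<close>, and send the whole witness through
  \<open>k\<close>. Only finitely many literals are checked, so a long enough piece of the
  characteristic function covers them.\<close>

lemma extension_exists:
  assumes B: "universe B = UNIV" and q: "good B q"
  shows "\<exists>s e. extension q n (map (char_fun (atomic_diagram L B)) [0..<s]) e"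
proof -
  obtain zs ys where q_def: "q = (zs, ys)" by (cases q)
  obtain k where k: "is_iso L M B k" and ys: "ys = map k zs" and zs: "prefix cs zs" "distinct zs"
    using q by (auto simp: good_def q_def)
  have bij: "bij k" using k univ B by (simp add: is_iso_def)
  obtain m where m: "k m = n" using bij by (metis bij_pointE)
  define zs' where "zs' = zs @ filter (\<lambda>x. x \<notin> set zs) (remdups [n, m])"
  have zs': "prefix zs zs'" "distinct zs'" "n \<in> set zs'" "m \<in> set zs'"
    using zs(2) by (auto simp: zs'_def)
  have "prefix cs zs'" using zs zs' by auto
  then have w: "pins zs' (witness zs')" using zs'(2) by (rule witness)
  define us where "us = map k (witness zs')"
  have pre: "prefix zs' (witness zs')" and dis: "distinct (witness zs')"
    using w by (auto simp: pins_def)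
  have take_us: "take (length zs') us = map k zs'" using pre by (auto simp: us_def prefix_def)
  have "finite {l. lit_number l < length us}"
    using finite_vimageI[OF finite_lessThan inj_lit_number] by (simp add: vimage_def)
  then have "finite ((\<lambda>l. lit_number (ren_lit ((!) us) l)) ` {l. lit_number l < length us})" by simp
  then obtain s where s: "\<And>l. lit_number l < length us \<Longrightarrow> lit_number (ren_lit ((!) us) l) < s"
    unfolding finite_nat_set_iff_bounded by blast
  have "agree L M (witness zs') B us" unfolding us_def by (rule agree_iso[OF univ B k])
  then have "lit_number l < length us \<Longrightarrow>
      lit_true L M (ren_lit ((!) (witness zs')) l) \<longleftrightarrow> lit_true L B (ren_lit ((!) us) l)" for l
    unfolding agree_def by (simp flip: pulled_diagram_lit)
  moreover have "prefix ys us" using zs'(1) pre by (auto simp: ys us_def prefix_def)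
  moreover have "distinct us"
    using dis bij by (simp add: us_def distinct_map bij_is_inj inj_on_subset[of k UNIV])
  moreover have "n \<in> set (take (length zs') us)" using take_us m zs'(4) by auto
  moreover have "length us = length (witness zs')" by (simp add: us_def)
  ultimately have "extension q n (map (char_fun (atomic_diagram L B)) [0..<s]) (zs', us)"
    using zs' s by (auto simp: extension_def q_def char_diagram_iff[unfolded One_nat_def])
  then show ?thesis by blast
qed

section \<open>A computable chain of partial isomorphisms\<close>

definition graph_of :: "nat \<Rightarrow> (nat \<times> nat) set" where
  "graph_of w = (let (zs, ys) = from_nat w in set (zip zs ys))"

lemma graph_of_good:
  assumes "good B (from_nat w)"
  shows "\<exists>k. is_iso L M B k \<and> (\<forall>x y. (x, y) \<in> graph_of w \<longrightarrow> y = k x)"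
proof -
  obtain zs ys :: "nat list" where q: "from_nat w = (zs, ys)" by fastforce
  then obtain k where "is_iso L M B k" "ys = map k zs" using assms by (auto simp: good_def)
  then show ?thesis by (auto simp: graph_of_def q set_zip)
qed

lemma computable_graphs:
  assumes B: "universe B = UNIV" and iso: "is_iso L M B k"
    and h: "char_fun (atomic_diagram L B) \<le>\<^sub>T h" "search_test \<le>\<^sub>T h" "search_next \<le>\<^sub>T h"
  obtains st where "st \<le>\<^sub>T h" and "\<And>n. good B (from_nat (st n))"
    and "\<And>m n. m \<le> n \<Longrightarrow> graph_of (st m) \<subseteq> graph_of (st n)"
    and "\<And>n. n \<in> fst ` graph_of (st (Suc n))" and "\<And>n. n \<in> snd ` graph_of (st (Suc n))"
proof -
  let ?D = "hist (char_fun (atomic_diagram L B))"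
  define nxt where "nxt q n = search_next (prod_encode
    (?D (least_stage ?D search_test (prod_encode (q, n))), prod_encode (q, n)))" for q n
  \<comment> \<open>The isomorphism enters only through the finitely many values
    \<open>map k cs\<close>, so \<open>st\<close> is computable although \<open>k\<close> need not
    be.\<close>
  define st where "st = rec_nat (to_nat (cs, map k cs)) (\<lambda>n q. nxt q n)"
  have st_simps: "st 0 = to_nat (cs, map k cs)" "\<And>n. st (Suc n) = nxt (st n) n"
    by (simp_all add: st_def)
  have test: "\<exists>s. search_test (prod_encode (?D s, prod_encode (q, n))) = 0"
    if "good B (from_nat q)" for q n
    using extension_exists[OF B that, of n] by (auto simp: search_test_def)
  have step: "good B (from_nat (nxt q n)) \<and> graph_of q \<subseteq> graph_of (nxt q n) \<and>
      n \<in> fst ` graph_of (nxt q n) \<and> n \<in> snd ` graph_of (nxt q n)" if q: "good B (from_nat q)" for q n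
  proof -
    obtain zs ys :: "nat list" where qd: "from_nat q = (zs, ys)" by fastforce
    let ?s = "least_stage ?D search_test (prod_encode (q, n))"
    let ?P = "extension (from_nat q) n (map (char_fun (atomic_diagram L B)) [0..<?s])"
    have ex: "\<exists>e. ?P e"
      using least_stage[where P = search_test and D = ?D, OF test[OF q, of n]]
      by (auto simp: search_test_def split: if_splits)
    obtain zs' us where e: "(SOME e. ?P e) = (zs', us)" by (cases "SOME e. ?P e")
    with someI_ex[OF ex] have ext: "?P (zs', us)" by simp
    have nxt: "nxt q n = to_nat (zs', take (length zs') us)"
      by (simp add: nxt_def search_next_def e)
    have good: "good B (from_nat (nxt q n))"
      unfolding nxt from_nat_to_nat by (rule good_extension[OF B q ext])
    have p: "prefix zs zs'" "prefix ys us" "n \<in> set zs'" "n \<in> set (take (length zs') us)"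
      using ext by (auto simp: extension_def qd)
    have len: "length ys = length zs" "length zs' = length (take (length zs') us)"
      using q good unfolding good_def qd nxt from_nat_to_nat fst_conv snd_conv
      by (metis length_map)+
    have "graph_of q \<subseteq> graph_of (nxt q n)"
      using p(1,2) len by (auto simp: graph_of_def qd nxt prefix_def)
    moreover have "fst ` graph_of (nxt q n) = set zs'" "snd ` graph_of (nxt q n) = set (take (length zs') us)"
      using len(2) unfolding graph_of_def nxt
      by (simp_all flip: set_map add: map_fst_zip map_snd_zip del: length_take)
    ultimately show ?thesis using good p by simp
  qed
  have good: "good B (from_nat (st n))" for n
  proof (induction n)
    case 0
    show ?case using cs iso by (auto simp: good_def st_simps)
  next
    case (Suc n)
    then show ?case using step by (simp add: st_simps)
  qed
  show thesis
  proof (rule that)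
    show "st \<le>\<^sub>T h"
      by (rule turing_le_primrec_search[OF turing_le_hist[OF h(1)] h(2,3) test[OF good]])
        (simp add: st_simps nxt_def)
    have "graph_of (st n) \<subseteq> graph_of (st (Suc n))" for n
      using step[OF good] by (simp add: st_simps)
    then show "m \<le> n \<Longrightarrow> graph_of (st m) \<subseteq> graph_of (st n)" for m n
      by (rule lift_Suc_mono_le[of "\<lambda>n. graph_of (st n)"])
    show "n \<in> fst ` graph_of (st (Suc n))" "n \<in> snd ` graph_of (st (Suc n))" for n
      using step[OF good] by (simp_all add: st_simps)
  qed (rule good)
qed

section \<open>Matching two copies through \<open>M\<close>\<close>

definition match_test :: "nat \<Rightarrow> nat" where
  "match_test w = (let (a, y) = prod_decode w; (q, q') = prod_decode a in
    if \<exists>x y'. (x, y) \<in> graph_of q \<and> (x, y') \<in> graph_of q' then 0 else 1)"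

definition match_value :: "nat \<Rightarrow> nat" where
  "match_value w = (let (a, y) = prod_decode w; (q, q') = prod_decode a in
    (SOME y'. \<exists>x. (x, y) \<in> graph_of q \<and> (x, y') \<in> graph_of q'))"

text \<open>Two chains of partial isomorphisms from \<open>M\<close>, into \<open>B\<close> and into
  \<open>B'\<close>, run side by side; \<open>y\<close> is sent to \<open>y'\<close> once both are
  images of the same \<open>x\<close>. All matches present at one stage belong to a single
  isomorphism, which gives uniqueness and local agreement.\<close>

lemma computable_iso:
  assumes B: "universe B = UNIV" "is_iso L M B k" "char_fun (atomic_diagram L B) \<le>\<^sub>T h"
    and B': "universe B' = UNIV" "is_iso L M B' k'" "char_fun (atomic_diagram L B') \<le>\<^sub>T h"
    and h: "search_test \<le>\<^sub>T h" "search_next \<le>\<^sub>T h" "match_test \<le>\<^sub>T h" "match_value \<le>\<^sub>T h"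
  shows "\<exists>f. is_iso L B B' f \<and> f \<le>\<^sub>T h"
proof -
  obtain st where st: "st \<le>\<^sub>T h" and good: "\<And>n. good B (from_nat (st n))"
    and mono: "\<And>m n. m \<le> n \<Longrightarrow> graph_of (st m) \<subseteq> graph_of (st n)"
    and dom: "\<And>n. n \<in> fst ` graph_of (st (Suc n))" and ran: "\<And>n. n \<in> snd ` graph_of (st (Suc n))"
    using computable_graphs[OF B h(1,2)] by blast
  obtain st' where st': "st' \<le>\<^sub>T h" and good': "\<And>n. good B' (from_nat (st' n))"
    and mono': "\<And>m n. m \<le> n \<Longrightarrow> graph_of (st' m) \<subseteq> graph_of (st' n)"
    and dom': "\<And>n. n \<in> fst ` graph_of (st' (Suc n))" and ran': "\<And>n. n \<in> snd ` graph_of (st' (Suc n))"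
    using computable_graphs[OF B' h(1,2)] by blast
  define R where "R s y y' \<longleftrightarrow> (\<exists>x. (x, y) \<in> graph_of (st s) \<and> (x, y') \<in> graph_of (st' s))" for s y y'
  have R_mono: "R s y y' \<Longrightarrow> s \<le> t \<Longrightarrow> R t y y'" for s t y y'
    unfolding R_def using mono mono' by blast
  have R_iso: "\<exists>j. is_iso L B B' j \<and> (\<forall>y y'. R s y y' \<longrightarrow> y' = j y)" for s
  proof -
    obtain k where k: "is_iso L M B k" "\<And>x y. (x, y) \<in> graph_of (st s) \<Longrightarrow> y = k x"
      using graph_of_good[OF good] by blast
    obtain k' where k': "is_iso L M B' k'" "\<And>x y. (x, y) \<in> graph_of (st' s) \<Longrightarrow> y = k' x"
      using graph_of_good[OF good'] by blast
    have "inj k" using k(1) univ by (simp add: is_iso_def bij_betw_def)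
    then have "\<forall>y y'. R s y y' \<longrightarrow> y' = (k' \<circ> inv_into (universe M) k) y"
      unfolding R_def using k(2) k'(2) univ by fastforce
    moreover have "is_iso L B B' (k' \<circ> inv_into (universe M) k)"
      by (rule is_iso_compose[OF is_iso_inv_into[OF M k(1)] k'(1)])
    ultimately show ?thesis by blast
  qed
  have total: "\<exists>s y'. R s y y'" for y
  proof -
    obtain x where x: "(x, y) \<in> graph_of (st (Suc y))" using ran[of y] by auto
    obtain y' where y': "(x, y') \<in> graph_of (st' (Suc x))" using dom'[of x] by auto
    have "R (max (Suc x) (Suc y)) y y'"
      unfolding R_def using x y' mono[of "Suc y" "max (Suc x) (Suc y)"]
        mono'[of "Suc x" "max (Suc x) (Suc y)"] by auto
    then show ?thesis by blast
  qed
  have onto: "\<exists>s y. R s y y'" for y'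
  proof -
    obtain x where x: "(x, y') \<in> graph_of (st' (Suc y'))" using ran'[of y'] by auto
    obtain y where y: "(x, y) \<in> graph_of (st (Suc x))" using dom[of x] by auto
    have "R (max (Suc x) (Suc y')) y y'"
      unfolding R_def using x y mono'[of "Suc y'" "max (Suc x) (Suc y')"]
        mono[of "Suc x" "max (Suc x) (Suc y')"] by auto
    then show ?thesis by blast
  qed
  let ?D = "\<lambda>s. prod_encode (st s, st' s)"
  define f where "f y = match_value (prod_encode (?D (least_stage ?D match_test y), y))" for y
  have ex: "\<exists>s. match_test (prod_encode (?D s, y)) = 0" for y
    using total[of y] by (auto simp: match_test_def R_def)
  have f: "\<exists>s. R s y (f y)" for y
  proof -
    have "\<exists>y'. R (least_stage ?D match_test y) y y'"
      using least_stage[where P = match_test and D = ?D, OF ex[of y]]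
      by (auto simp: match_test_def R_def split: if_splits)
    from someI_ex[OF this] show ?thesis by (auto simp: f_def match_value_def R_def)
  qed
  have f_unique: "y' = f y" if "R s y y'" for s y y'
  proof -
    obtain t where t: "R t y (f y)" using f by blast
    obtain j where "\<forall>y y'. R (max s t) y y' \<longrightarrow> y' = j y" using R_iso by blast
    then show ?thesis using R_mono[OF t, of "max s t"] R_mono[OF that, of "max s t"]
      by (metis max.cobounded1 max.cobounded2)
  qed
  have "is_iso L B B' f"
  proof (rule is_iso_local[OF B(1) B'(1)])
    fix N
    obtain s where s: "\<And>y. R (s y) y (f y)" using f by metis
    \<comment> \<open>All matches for \<open>y < N\<close> have appeared by stage \<open>?t\<close>,
      so one isomorphism accounts for them. Inserting 0 keeps the set nonempty when
      \<open>N = 0\<close>.\<close>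
    let ?t = "Max (insert 0 (s ` {..<N}))"
    obtain j where j: "is_iso L B B' j" "\<forall>y y'. R ?t y y' \<longrightarrow> y' = j y" using R_iso by blast
    have "f y = j y" if "y < N" for y
      using j(2) R_mono[OF s, of y ?t] that by simp
    with j(1) show "\<exists>k. is_iso L B B' k \<and> (\<forall>y<N. f y = k y)" by blast
  next
    show "surj f" using onto f_unique by (metis surjI)
  qed
  moreover have "f \<le>\<^sub>T h"
    unfolding f_def by (rule turing_le_search[OF turing_le_pair[OF st st'] h(3,4) ex])
  ultimately show ?thesis by blast
qed

end

lemma not_dense_free_categorical:
  assumes A: "is_structure L A" and copy: "is_structure L M" "universe M = UNIV" "is_iso L A M k"
    and "\<not> dense_free L M"
  shows "\<exists>e. comp_categorical_on_cone L A e"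
proof -
  obtain cs where "distinct cs" "\<And>zs. prefix cs zs \<Longrightarrow> distinct zs \<Longrightarrow> \<not> free_over L M (length cs) zs"
    using assms(5) unfolding dense_free_def by blast
  then interpret few_free L M cs using copy by unfold_locales
  \<comment> \<open>These four functions depend on nothing beyond \<open>L\<close>, \<open>M\<close>
    and \<open>cs\<close>, so the same base serves every pair of copies.\<close>
  let ?e = "sup (sup (degree_of search_test) (degree_of search_next))
    (sup (degree_of match_test) (degree_of match_value))"
  have "comp_categorical_on_cone L A ?e"
    unfolding comp_categorical_on_cone_def
  proof (intro allI impI)
    fix c B B' assume c: "?e \<le> c" and B: "computable_copy L A c B" and B': "computable_copy L A c B'"
    obtain h where h: "c = degree_of h" by (rule degree_of_surj)
    have iso: "\<exists>j. is_iso L M C j" if "computable_copy L A c C" for C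
      using that is_iso_compose[OF is_iso_inv_into[OF A copy(3)]] unfolding computable_copy_def by blast
    obtain j j' where "is_iso L M B j" "is_iso L M B' j'" using iso[OF B] iso[OF B'] by blast
    with c B B' have "\<exists>f. is_iso L B B' f \<and> f \<le>\<^sub>T h"
      by (intro computable_iso) (auto simp: computable_copy_def h degree_of_le_iff)
    then show "\<exists>f. is_iso L B B' f \<and> degree_of f \<le> c" by (simp add: h degree_of_le_iff)
  qed
  then show ?thesis by blast
qed

section \<open>Coding a c.e. set into a copy\<close>

definition last_block :: "nat list list \<Rightarrow> nat list" where
  "last_block ps = (if ps = [] then [] else last ps)"

definition fill :: "nat list \<Rightarrow> nat list" where
  "fill xs = xs @ [LEAST y. y \<notin> set xs]"

lemma last_block_take_Suc: "i < length ps \<Longrightarrow> last_block (take (Suc i) ps) = ps ! i"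
  by (auto simp: last_block_def take_Suc_conv_app_nth)

lemma last_block_snoc [simp]: "last_block (ps @ [xs]) = xs"
  by (simp add: last_block_def)

lemma least_missing: "(LEAST y. y \<notin> set xs) \<notin> set (xs :: nat list)"
  by (rule LeastI_ex) (meson ex_new_if_finite finite_set infinite_UNIV_nat)

lemma distinct_fill: "distinct xs \<Longrightarrow> distinct (fill xs)"
  using least_missing by (simp add: fill_def)

lemma fill_covers:
  assumes "{..<n} \<subseteq> set xs"
  shows "{..n} \<subseteq> set (fill xs)"
proof -
  have "n \<in> set (fill xs)"
  proof (cases "n \<in> set xs")
    case False
    have "(LEAST y. y \<notin> set xs) = n"
      using False assms by (intro Least_equality) (auto simp: subset_iff not_less[symmetric])
    then show ?thesis by (simp add: fill_def)
  qed (simp add: fill_def)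
  moreover have "{..<n} \<subseteq> set (fill xs)" using assms by (auto simp: fill_def)
  moreover have "{..n} = insert n {..<n}" by auto
  ultimately show ?thesis by simp
qed

lemma prefix_fill: "prefix xs (fill xs)"
  by (simp add: fill_def)

lemma pulled_diagram_prefix:
  assumes "prefix xs ys" and "n < length xs"
  shows "n \<in> pulled_diagram L A ((!) xs) \<longleftrightarrow> n \<in> pulled_diagram L A ((!) ys)"
  using assms by (intro pulled_diagram_cong) (auto simp: prefix_def nth_append)

lemma prefix_nth: "prefix xs ys \<Longrightarrow> n < length xs \<Longrightarrow> xs ! n = ys ! n"
  by (auto simp: prefix_def nth_append)

locale coding =
  fixes L :: language and M :: model and A :: model and h :: "nat \<Rightarrow> nat"
  assumes M: "is_structure L M" and univ: "universe M = UNIV"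
    and A: "is_structure L A" and h: "is_iso L A M h"
    and dense: "dense_free L M"
begin

text \<open>\<open>last_block (take m ps)\<close> is block \<open>m - 1\<close>, or empty for
  \<open>m = 0\<close>. So the entries below block \<open>m\<close> stay, while of the later ones
  only the decided diagram is preserved.\<close>

definition moved :: "nat list list \<Rightarrow> nat \<Rightarrow> nat list \<Rightarrow> bool" where
  "moved ps m xs \<longleftrightarrow> distinct xs \<and> agree L M (last_block ps) M xs \<and>
    take (length (last_block (take m ps))) xs = take (length (last_block (take m ps))) (last_block ps) \<and>
    \<not> same_orbit L M (ps ! m) (take (length (ps ! m)) xs)"

text \<open>The blocks above \<open>m\<close> are discarded, but the new block \<open>m\<close> is
  at least as long as the old last block, so no decided literal is lost. \<open>fill\<close> makes
  sure that it contains \<open>m\<close>.\<close>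

definition act :: "nat list list \<Rightarrow> nat \<Rightarrow> nat list list" where
  "act ps m = take m ps @ [fill (SOME xs. moved ps m xs)]"

definition next_block :: "nat list list \<Rightarrow> nat list \<Rightarrow> bool" where
  "next_block ps zs \<longleftrightarrow> prefix (fill (last_block ps)) zs \<and> distinct zs \<and>
    free_over L M (length (last_block ps)) zs"

definition grow :: "nat list list \<Rightarrow> nat list list" where
  "grow ps = ps @ [SOME zs. next_block ps zs]"

text \<open>A state consists of an increasing chain of blocks, whose last member is the current finite
  part of the isomorphism from the copy onto \<open>M\<close>, and of the numbers enumerated so far.
  Block \<open>i\<close> is free over block \<open>i - 1\<close> until \<open>i\<close> is enumerated; then it is moved out of its orbit.\<close>

definition step :: "nat list list \<times> nat list \<Rightarrow> nat \<Rightarrow> nat list list \<times> nat list" where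
  "step q m = (let (ps, S) = q in
    (grow (if m < length ps \<and> m \<notin> set S then act ps m else ps), m # S))"

text \<open>Containing all numbers up to \<open>i\<close> makes the limit onto, and forces block
  \<open>i\<close> to have more than \<open>i\<close> entries.\<close>

definition wf_state :: "nat list list \<Rightarrow> nat set \<Rightarrow> bool" where
  "wf_state ps S \<longleftrightarrow> (\<forall>i<length ps. distinct (ps ! i) \<and> {..i} \<subseteq> set (ps ! i) \<and>
    prefix (last_block (take i ps)) (ps ! i) \<and>
    (i \<notin> S \<longrightarrow> free_over L M (length (last_block (take i ps))) (ps ! i)))"

lemma wf_state_mono: "wf_state ps S \<Longrightarrow> S \<subseteq> S' \<Longrightarrow> wf_state ps S'"
  by (auto simp: wf_state_def)

lemma wf_state_snoc:
  assumes "wf_state ps S" and "distinct zs" and "{..length ps} \<subseteq> set zs" and "prefix (last_block ps) zs"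
    and "length ps \<notin> S \<Longrightarrow> free_over L M (length (last_block ps)) zs"
  shows "wf_state (ps @ [zs]) S"
  using assms by (auto simp: wf_state_def nth_append less_Suc_eq)

lemma wf_state_take: "wf_state ps S \<Longrightarrow> wf_state (take m ps) S"
  by (auto simp: wf_state_def min_def)

lemma wf_state_prefix:
  assumes "wf_state ps S" and "i \<le> j" and "j < length ps"
  shows "prefix (ps ! i) (ps ! j)"
  using assms(2,3)
proof (induction j rule: dec_induct)
  case (step j)
  have "prefix (ps ! j) (ps ! Suc j)"
    using assms(1) step.prems last_block_take_Suc[of j ps] by (auto simp: wf_state_def)
  with step show ?case by (meson Suc_lessD prefix_order.trans)
qed simp

lemma last_block_nth: "ps \<noteq> [] \<Longrightarrow> last_block ps = ps ! (length ps - 1)"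
  by (simp add: last_block_def last_conv_nth)

lemma wf_state_prefix_last_block:
  assumes "wf_state ps S" and "i < length ps"
  shows "prefix (ps ! i) (last_block ps)"
proof -
  have "ps \<noteq> []" using assms(2) by auto
  then show ?thesis using wf_state_prefix[OF assms(1), of i "length ps - 1"] assms(2)
    by (simp add: last_block_nth)
qed

lemma wf_state_take_last_block:
  assumes "wf_state ps S" and "m \<le> length ps"
  shows "prefix (last_block (take m ps)) (last_block ps)"
proof (cases m)
  case 0
  then show ?thesis by (simp add: last_block_def)
next
  case (Suc i)
  then show ?thesis using assms wf_state_prefix_last_block[OF assms(1), of i] by (simp add: last_block_take_Suc)
qed

lemma wf_state_last_block:
  assumes "wf_state ps S"
  shows "distinct (last_block ps)" and "{..<length ps} \<subseteq> set (last_block ps)"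
proof -
  have "distinct (last_block ps) \<and> {..<length ps} \<subseteq> set (last_block ps)"
  proof (cases "ps = []")
    case True
    then show ?thesis by (simp add: last_block_def)
  next
    case False
    then have "length ps - 1 < length ps" by simp
    then have "distinct (ps ! (length ps - 1)) \<and> {..length ps - 1} \<subseteq> set (ps ! (length ps - 1))"
      using assms unfolding wf_state_def by blast
    moreover have "{..length ps - 1} = {..<length ps}" using False by (cases ps) auto
    ultimately show ?thesis using False by (simp add: last_block_nth)
  qed
  then show "distinct (last_block ps)" and "{..<length ps} \<subseteq> set (last_block ps)" by auto
qed

lemma wf_state_length:
  assumes "wf_state ps S" and "i < length ps"
  shows "i < length (ps ! i)"
proof -
  have "{..i} \<subseteq> set (ps ! i)" using assms by (simp add: wf_state_def)
  then have "card {..i} \<le> card (set (ps ! i))" by (intro card_mono) auto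
  then show ?thesis using card_length[of "ps ! i"] by simp
qed

text \<open>Freeness of block \<open>m\<close> over block \<open>m - 1\<close> is applied to the
  current last block, taken as the extension of block \<open>m\<close>.\<close>

lemma act_moved:
  assumes "wf_state ps S" and "m < length ps" and "m \<notin> S"
  obtains xs where "moved ps m xs" and "act ps m = take m ps @ [fill xs]"
proof -
  have "free_over L M (length (last_block (take m ps))) (ps ! m)"
    using assms by (simp add: wf_state_def)
  then have "\<exists>xs. moved ps m xs"
    using wf_state_last_block(1)[OF assms(1)] wf_state_prefix_last_block[OF assms(1,2)]
    unfolding free_over_def moved_def by blast
  from someI_ex[OF this] show thesis using that by (simp add: act_def)
qed

lemma moved_prefix:
  assumes "wf_state ps S" and "m < length ps" and "moved ps m xs"
  shows "prefix (last_block (take m ps)) xs"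
proof -
  have "take (length (last_block (take m ps))) xs = last_block (take m ps)"
    using assms(3) wf_state_take_last_block[OF assms(1), of m] assms(2) by (auto simp: moved_def prefix_def)
  then show ?thesis by (metis take_is_prefix)
qed

text \<open>Below \<open>m\<close> nothing changes, and the new block \<open>m\<close> may fail to
  be free since \<open>m\<close> now counts as enumerated.\<close>

lemma wf_state_act:
  assumes "wf_state ps S" and "m < length ps" and "m \<notin> S"
  shows "wf_state (act ps m) (insert m S)"
proof -
  obtain xs where xs: "moved ps m xs" and act: "act ps m = take m ps @ [fill xs]"
    using act_moved[OF assms] by blast
  note pre = moved_prefix[OF assms(1,2) xs]
  have "{..<length (take m ps)} \<subseteq> set xs"
    using wf_state_last_block(2)[OF wf_state_take[OF assms(1), of m]] set_mono_prefix[OF pre] by blast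
  then have "{..m} \<subseteq> set (fill xs)" using assms(2) by (intro fill_covers) simp
  moreover have "distinct (fill xs)" using xs by (simp add: moved_def distinct_fill)
  moreover have "prefix (last_block (take m ps)) (fill xs)" 
    using pre prefix_fill by (rule prefix_order.trans)
  ultimately show ?thesis
    unfolding act using assms(1,2)
    by (intro wf_state_snoc wf_state_mono[OF wf_state_take]) auto
qed

lemma grow_next:
  assumes "wf_state ps S"
  obtains zs where "next_block ps zs" and "grow ps = ps @ [zs]"
proof -
  \<comment> \<open>Density applied to the filled last block gives freeness over one entry more than
    required; \<open>free_over_mono\<close> drops it.\<close>
  obtain zs where "prefix (fill (last_block ps)) zs" "distinct zs" "free_over L M (length (fill (last_block ps))) zs"
    using dense distinct_fill[OF wf_state_last_block(1)[OF assms]] unfolding dense_free_def by blast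
  then have "next_block ps zs"
    by (auto simp: next_block_def fill_def intro: free_over_mono)
  then have "next_block ps (SOME zs. next_block ps zs)" by (rule someI)
  then show thesis using that by (simp add: grow_def)
qed

lemma wf_state_grow:
  assumes "wf_state ps S"
  shows "wf_state (grow ps) S"
proof -
  obtain zs where zs: "next_block ps zs" and grow: "grow ps = ps @ [zs]"
    using grow_next[OF assms] by blast
  have "{..length ps} \<subseteq> set zs"
    using fill_covers[OF wf_state_last_block(2)[OF assms]] zs set_mono_prefix[of "fill (last_block ps)" zs]
    by (auto simp: next_block_def)
  then show ?thesis
    unfolding grow using assms zs prefix_fill
    by (intro wf_state_snoc) (auto simp: next_block_def intro: prefix_order.trans)
qed

text \<open>Weaker than \<open>prefix\<close>: a move may replace entries, but what the last block
  has decided stays. This is why the diagram of the copy is computable although its isomorphism onto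
  \<open>M\<close> need not be.\<close>

definition extends_last_block :: "nat list list \<Rightarrow> nat list list \<Rightarrow> bool" where
  "extends_last_block ps ps' \<longleftrightarrow> length (last_block ps) \<le> length (last_block ps') \<and>
    (\<forall>n<length (last_block ps).
      n \<in> pulled_diagram L M ((!) (last_block ps)) \<longleftrightarrow> n \<in> pulled_diagram L M ((!) (last_block ps')))"

lemma extends_last_block_trans:
  "extends_last_block ps ps' \<Longrightarrow> extends_last_block ps' ps'' \<Longrightarrow> extends_last_block ps ps''"
  by (auto simp: extends_last_block_def)

lemma extends_last_block_act:
  assumes "wf_state ps S" and "m < length ps" and "m \<notin> S"
  shows "extends_last_block ps (act ps m)"
proof -
  obtain xs where xs: "moved ps m xs" and act: "act ps m = take m ps @ [fill xs]"
    using act_moved[OF assms] by blast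
  then have "agree L M (last_block ps) M xs" by (simp add: moved_def)
  moreover have "length xs \<le> length (fill xs)" by (simp add: fill_def)
  ultimately show ?thesis
    using pulled_diagram_prefix[OF prefix_fill]
    unfolding extends_last_block_def agree_def act last_block_snoc by metis
qed

lemma extends_last_block_grow:
  assumes "wf_state ps S"
  shows "extends_last_block ps (grow ps)" and "length (last_block ps) < length (last_block (grow ps))"
proof -
  obtain zs where zs: "next_block ps zs" and grow: "grow ps = ps @ [zs]"
    using grow_next[OF assms] by blast
  then have pre: "prefix (fill (last_block ps)) zs" by (simp add: next_block_def)
  then have "prefix (last_block ps) zs" using prefix_fill prefix_order.trans by blast
  moreover have "length (last_block ps) < length zs"
    using prefix_length_le[OF pre] by (simp add: fill_def)
  ultimately show "extends_last_block ps (grow ps)" and "length (last_block ps) < length (last_block (grow ps))"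
    using pulled_diagram_prefix unfolding extends_last_block_def grow last_block_snoc
    by (blast intro: less_imp_le)+
qed

section \<open>Stages of the construction and their limit\<close>

primrec stage :: "(nat \<Rightarrow> nat) \<Rightarrow> nat \<Rightarrow> nat list list \<times> nat list" where
  "stage g 0 = ([], [])"
| "stage g (Suc s) = step (stage g s) (g s)"

definition blocks :: "(nat \<Rightarrow> nat) \<Rightarrow> nat \<Rightarrow> nat list list" where
  "blocks g s = fst (stage g s)"

lemma set_snd_stage: "set (snd (stage g s)) = g ` {..<s}"
  by (induction s) (auto simp: step_def lessThan_Suc split: prod.splits)

lemma blocks_0: "blocks g 0 = []"
  by (simp add: blocks_def)

lemma blocks_Suc:
  "blocks g (Suc s) = grow (if g s < length (blocks g s) \<and> g s \<notin> g ` {..<s}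
    then act (blocks g s) (g s) else blocks g s)"
  by (simp add: blocks_def step_def set_snd_stage[symmetric] split: prod.splits)

lemma wf_blocks: "wf_state (blocks g s) (g ` {..<s})"
proof (induction s)
  case 0
  show ?case by (simp add: blocks_0 wf_state_def)
next
  case (Suc s)
  have "g ` {..<Suc s} = insert (g s) (g ` {..<s})" by (simp add: lessThan_Suc)
  with Suc show ?case
    unfolding blocks_Suc
    by (auto intro!: wf_state_grow wf_state_act intro: wf_state_mono)
qed

lemma extends_last_block_Suc:
  "extends_last_block (blocks g s) (blocks g (Suc s)) \<and>
    length (last_block (blocks g s)) < length (last_block (blocks g (Suc s)))"
proof (cases "g s < length (blocks g s) \<and> g s \<notin> g ` {..<s}")
  case True
  then have a: "extends_last_block (blocks g s) (act (blocks g s) (g s))"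
    using extends_last_block_act[OF wf_blocks] by blast
  have "wf_state (act (blocks g s) (g s)) (insert (g s) (g ` {..<s}))"
    using True wf_state_act[OF wf_blocks] by blast
  from a extends_last_block_grow[OF this] show ?thesis
    using True extends_last_block_trans by (auto simp: blocks_Suc extends_last_block_def)
next
  case False
  then have "blocks g (Suc s) = grow (blocks g s)" unfolding blocks_Suc by (rule if_not_P[THEN arg_cong])
  then show ?thesis using extends_last_block_grow[OF wf_blocks] by simp
qed

lemma extends_last_block_le:
  assumes "s \<le> t"
  shows "extends_last_block (blocks g s) (blocks g t)"
  using assms
proof (induction t rule: dec_induct)
  case base
  show ?case by (simp add: extends_last_block_def)
next
  case (step t)
  then show ?case using extends_last_block_Suc extends_last_block_trans by blast
qed

lemma stage_le_length_last_block: "s \<le> length (last_block (blocks g s))"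
proof (induction s)
  case (Suc s)
  then show ?case using extends_last_block_Suc[of g s] by linarith
qed simp

text \<open>Block \<open>i\<close> can be disturbed only by the first enumeration of some number up
  to \<open>i\<close>; at a settled stage none is left.\<close>

definition settled :: "(nat \<Rightarrow> nat) \<Rightarrow> nat \<Rightarrow> nat \<Rightarrow> bool" where
  "settled g s i \<longleftrightarrow> i < length (blocks g s) \<and> (\<forall>j\<le>i. j \<in> range g \<longrightarrow> j \<in> g ` {..<s})"

lemma blocks_Suc_nth:
  assumes "i < length (blocks g s)" and "g s \<le> i \<Longrightarrow> g s \<in> g ` {..<s}"
  shows "i < length (blocks g (Suc s)) \<and> blocks g (Suc s) ! i = blocks g s ! i"
  using assms by (auto simp: blocks_Suc grow_def act_def nth_append)

lemma settled_Suc: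
  assumes "settled g s i"
  shows "settled g (Suc s) i" and "blocks g (Suc s) ! i = blocks g s ! i"
  using assms blocks_Suc_nth[of i g s] by (auto simp: settled_def less_Suc_eq)

lemma settled_le:
  assumes "settled g s i" and "s \<le> t"
  shows "settled g t i \<and> blocks g t ! i = blocks g s ! i"
  using assms(2)
proof (induction t rule: dec_induct)
  case (step t)
  then show ?case using settled_Suc[of g t i] by simp
qed (use assms(1) in simp)

lemma settled_exists: "\<exists>s. settled g s i"
proof -
  have "\<exists>s. \<forall>j\<le>i. j \<in> range g \<longrightarrow> j \<in> g ` {..<s}"
  proof -
    obtain f where f: "\<And>j. j \<in> range g \<Longrightarrow> g (f j) = j" by (metis f_inv_into_f)
    have "f j < Suc (Max (f ` {..i}))" if "j \<le> i" for j
      using that by (simp add: less_Suc_eq_le)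
    then show ?thesis using f by (metis imageI lessThan_iff)
  qed
  then obtain s where s: "\<And>j. j \<le> i \<Longrightarrow> j \<in> range g \<Longrightarrow> j \<in> g ` {..<s}" by blast
  \<comment> \<open>From stage \<open>s\<close> on no number up to \<open>i\<close> is new. So each
    further stage either keeps a block \<open>n\<close> already present or, if there are exactly
    \<open>n\<close> blocks, discards none and appends one.\<close>
  have "n \<le> length (blocks g (s + n))" if "n \<le> Suc i" for n
    using that
  proof (induction n)
    case (Suc n)
    show ?case
    proof (cases "n < length (blocks g (s + n))")
      case True
      have "g (s + n) \<le> n \<Longrightarrow> g (s + n) \<in> g ` {..<s + n}"
        using s[of "g (s + n)"] Suc.prems by fastforce
      from blocks_Suc_nth[OF True this] show ?thesis by simp
    next
      case False
      with Suc have len: "length (blocks g (s + n)) = n" by simp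
      have "\<not> (g (s + n) < n \<and> g (s + n) \<notin> g ` {..<s + n})"
        using s[of "g (s + n)"] Suc.prems by fastforce
      then show ?thesis by (auto simp: blocks_Suc grow_def len)
    qed
  qed simp
  then have "settled g (s + Suc i) i"
    using s unfolding settled_def by (fastforce simp: Suc_le_eq)
  then show ?thesis by blast
qed

text \<open>Block \<open>x\<close> has more than \<open>x\<close> entries, so it has a position
  \<open>x\<close>; every stage settled for \<open>x\<close> gives the same value.\<close>

definition limit :: "(nat \<Rightarrow> nat) \<Rightarrow> nat \<Rightarrow> nat" where
  "limit g x = blocks g (SOME s. settled g s x) ! x ! x"

lemma limit_nth:
  assumes "settled g s i" and "x < length (blocks g s ! i)"
  shows "limit g x = blocks g s ! i ! x"
proof -
  define t where "t = (SOME s. settled g s x)"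
  define u where "u = max s t"
  have t: "settled g t x" unfolding t_def by (rule someI_ex[OF settled_exists])
  have ui: "settled g u i" "blocks g u ! i = blocks g s ! i"
    using settled_le[OF assms(1), of u] by (simp_all add: u_def)
  have ux: "settled g u x" "blocks g u ! x = blocks g t ! x"
    using settled_le[OF t, of u] by (simp_all add: u_def)
  have "prefix (blocks g u ! i) (last_block (blocks g u))" "prefix (blocks g u ! x) (last_block (blocks g u))"
    using ui(1) ux(1) wf_state_prefix_last_block[OF wf_blocks] by (auto simp: settled_def)
  moreover have "x < length (blocks g u ! x)"
    using ux(1) wf_state_length[OF wf_blocks] by (auto simp: settled_def)
  ultimately have "blocks g u ! x ! x = blocks g u ! i ! x"
    using assms(2) ui(2) by (simp add: prefix_nth)
  then show ?thesis by (simp add: limit_def ui(2) ux(2) flip: t_def)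
qed

lemma limit_map:
  assumes "settled g s i" and "k \<le> length (blocks g s ! i)"
  shows "map (limit g) [0..<k] = take k (blocks g s ! i)"
  using assms by (intro nth_equalityI) (auto simp: limit_nth)

text \<open>Injective because blocks are distinct, onto because block \<open>y\<close> contains
  \<open>y\<close>.\<close>

lemma bij_limit: "bij (limit g)"
proof (rule bijI)
  show "inj (limit g)"
  proof (rule injI)
    fix x y assume eq: "limit g x = limit g y"
    obtain s where s: "settled g s (max x y)" using settled_exists by blast
    have "max x y < length (blocks g s ! max x y)" "distinct (blocks g s ! max x y)"
      using s wf_state_length[OF wf_blocks] wf_blocks[of g s] unfolding settled_def wf_state_def by blast+
    then show "x = y" using eq limit_nth[OF s] by (simp add: nth_eq_iff_index_eq)
  qed
  show "surj (limit g)"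
  proof (rule surjI[of _ "\<lambda>y. SOME x. limit g x = y"])
    fix y
    obtain s where s: "settled g s y" using settled_exists by blast
    then have "y \<in> set (blocks g s ! y)" using wf_blocks[of g s] by (auto simp: settled_def wf_state_def)
    then have "\<exists>x. limit g x = y" 
      unfolding in_set_conv_nth using limit_nth[OF s] by metis
    then show "limit g (SOME x. limit g x = y) = y" by (rule someI_ex)
  qed
qed

text \<open>Otherwise some number up to \<open>i\<close> has still to enter. For the least such
  \<open>j\<close>, block \<open>j\<close> stays unchanged until \<open>j\<close> appears, is then
  moved out of its orbit, and is final from there on. As block \<open>j\<close> is a prefix of block
  \<open>i\<close>, this contradicts \<open>orbit\<close>.\<close>

lemma settled_if_orbit:
  assumes i: "i < length (blocks g s)"
    and orbit: "same_orbit L M (blocks g s ! i) (map (limit g) [0..<length (blocks g s ! i)])"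
  shows "settled g s i"
proof (rule ccontr)
  assume "\<not> settled g s i"
  then have ex: "\<exists>j. j \<le> i \<and> j \<in> range g \<and> j \<notin> g ` {..<s}" (is "\<exists>j. ?new j")
    using i by (auto simp: settled_def)
  define j where "j = (LEAST j. ?new j)"
  have j: "j \<le> i" "j \<in> range g" "j \<notin> g ` {..<s}"
    using LeastI_ex[OF ex] by (simp_all add: j_def)
  have j_least: "m \<in> g ` {..<s}" if "m < j" "m \<in> range g" for m
  proof -
    have "\<not> ?new m" using that(1) unfolding j_def by (rule not_less_Least)
    with that j(1) show ?thesis by simp
  qed
  define t where "t = (LEAST t. g t = j)"
  have "\<exists>t. g t = j" using j(2) by auto
  then have t: "g t = j" unfolding t_def by (rule LeastI_ex)
  have before: "g u \<noteq> j" if "u < t" for u using that unfolding t_def by (rule not_less_Least)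
  have "s \<le> t" using t j(3) by (auto intro: leI)
  have keep: "j < length (blocks g u) \<and> blocks g u ! j = blocks g s ! j" if "s \<le> u" "u \<le> t" for u
    using that
  proof (induction u rule: dec_induct)
    case base
    show ?case using i j(1) by simp
  next
    case (step u)
    \<comment> \<open>Before stage \<open>t\<close> a number up to \<open>j\<close> that gets
      enumerated is below \<open>j\<close>, hence old by minimality of \<open>j\<close>.\<close>
    have "g u \<in> g ` {..<u}" if "g u \<le> j"
    proof -
      have "g u \<in> g ` {..<s}" using j_least[of "g u"] before[of u] that step by force
      then show ?thesis using step(1) by auto
    qed
    then show ?case using step blocks_Suc_nth[of j g u] by simp
  qed
  let ?ps = "blocks g t"
  have act: "j < length ?ps" "j \<notin> g ` {..<t}" "?ps ! j = blocks g s ! j"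
    using keep[OF \<open>s \<le> t\<close>] before by auto
  obtain xs where xs: "moved ?ps j xs" and act_eq: "act ?ps j = take j ?ps @ [fill xs]"
    using act_moved[OF wf_blocks act(1,2)] by blast
  have new: "blocks g (Suc t) ! j = fill xs" "j < length (blocks g (Suc t))"
    using act(1,2) by (auto simp: blocks_Suc t act_eq grow_def nth_append)
  have "settled g (Suc t) j"
    unfolding settled_def
  proof (intro conjI allI impI)
    fix m assume "m \<le> j" "m \<in> range g"
    then show "m \<in> g ` {..<Suc t}"
      using j_least[of m] t \<open>s \<le> t\<close> by (cases "m = j") fastforce+
  qed (rule new)
  \<comment> \<open>\<open>agree\<close> makes \<open>xs\<close> as long as the last block, so the
    entry added by \<open>fill\<close> lies beyond the positions of the old block
    \<open>j\<close>.\<close>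
  moreover have "length (?ps ! j) \<le> length xs"
    using prefix_length_le[OF wf_state_prefix_last_block[OF wf_blocks act(1)]] xs
    by (simp add: moved_def agree_def)
  ultimately have lim: "map (limit g) [0..<length (?ps ! j)] = take (length (?ps ! j)) xs"
    using limit_map[of g "Suc t" j "length (?ps ! j)"] new by (simp add: fill_def)
  have pre: "prefix (blocks g s ! j) (blocks g s ! i)"
    by (rule wf_state_prefix[OF wf_blocks j(1) i])
  then have "take (length (blocks g s ! j)) (blocks g s ! i) = blocks g s ! j"
    by (auto simp: prefix_def)
  moreover have "take (length (blocks g s ! j)) (map (limit g) [0..<length (blocks g s ! i)]) =
      map (limit g) [0..<length (blocks g s ! j)]"
    using prefix_length_le[OF pre] by (simp add: take_map min_def)
  ultimately have "same_orbit L M (?ps ! j) (take (length (?ps ! j)) xs)"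
    using same_orbit_take[OF orbit, of "length (blocks g s ! j)"] lim by (simp add: act(3))
  then show False using xs by (simp add: moved_def)
qed

section \<open>The copy determined by the limit, and its diagram\<close>

definition coded_copy :: "(nat \<Rightarrow> nat) \<Rightarrow> model" where
  "coded_copy g = \<lparr>universe = UNIV, rel_interp = (\<lambda>s xs. rel_interp M s (map (limit g) xs)),
    fun_interp = (\<lambda>s xs. inv (limit g) (fun_interp M s (map (limit g) xs)))\<rparr>"

lemma is_iso_limit: "is_iso L (coded_copy g) M (limit g)"
  using bij_limit[of g] univ by (simp add: is_iso_def coded_copy_def bij_is_surj surj_f_inv_f)

lemma universe_coded_copy: "universe (coded_copy g) = UNIV"
  by (simp add: coded_copy_def)

lemma is_structure_coded_copy: "is_structure L (coded_copy g)"
  by (simp add: is_structure_def universe_coded_copy)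

text \<open>The last block at stage \<open>Suc n\<close> has more than \<open>n\<close> entries and
  so decides \<open>n\<close>. Its entries may differ from the limit, but later stages preserve its
  decisions up to a stage where block \<open>n\<close> is final.\<close>

lemma atomic_diagram_coded_copy:
  "n \<in> atomic_diagram L (coded_copy g) \<longleftrightarrow>
    n \<in> pulled_diagram L M ((!) (last_block (blocks g (Suc n))))"
proof -
  obtain s0 where "settled g s0 n" using settled_exists by blast
  define s where "s = max s0 (Suc n)"
  have s: "settled g s n" using settled_le[OF \<open>settled g s0 n\<close>, of s] by (simp add: s_def)
  then have n: "n < length (blocks g s)" by (simp add: settled_def)
  have len: "n < length (blocks g s ! n)" by (rule wf_state_length[OF wf_blocks n])
  have "n \<in> atomic_diagram L (coded_copy g) \<longleftrightarrow> n \<in> pulled_diagram L M (limit g)"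
    using pulled_diagram_iso[OF universe_coded_copy univ is_iso_limit, of g "\<lambda>x. x"]
    by (simp add: pulled_diagram_id comp_def)
  also have "\<dots> \<longleftrightarrow> n \<in> pulled_diagram L M ((!) (blocks g s ! n))"
    using limit_nth[OF s] len by (intro pulled_diagram_cong) simp
  also have "\<dots> \<longleftrightarrow> n \<in> pulled_diagram L M ((!) (last_block (blocks g s)))"
    by (rule pulled_diagram_prefix[OF wf_state_prefix_last_block[OF wf_blocks n] len])
  also have "\<dots> \<longleftrightarrow> n \<in> pulled_diagram L M ((!) (last_block (blocks g (Suc n))))"
    using extends_last_block_le[of "Suc n" s g] stage_le_length_last_block[of "Suc n" g]
    by (simp add: extends_last_block_def s_def)
  finally show ?thesis .
qed

lemma is_iso_coded_copy: "is_iso L A (coded_copy g) (\<lambda>x. inv (limit g) (h x))"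
  using is_iso_compose[OF h is_iso_inv_into[OF is_structure_coded_copy is_iso_limit], of g]
  by (simp add: universe_coded_copy comp_def)

section \<open>Computing the diagram and an isomorphism\<close>

definition step_code :: "nat \<Rightarrow> nat" where
  "step_code w = (let (q, m) = prod_decode w in to_nat (step (from_nat q) m))"

definition stage_code :: "(nat \<Rightarrow> nat) \<Rightarrow> nat \<Rightarrow> nat" where
  "stage_code g s = to_nat (stage g s)"

lemma turing_le_stage_code:
  assumes "step_code \<le>\<^sub>T b" and "g \<le>\<^sub>T b"
  shows "stage_code g \<le>\<^sub>T b"
  by (rule turing_le_primrec[OF assms]) (simp add: stage_code_def step_code_def)

definition diagram_code :: "nat \<Rightarrow> nat" where
  "diagram_code w = (let (q, n) = prod_decode w; (ps, S) = (from_nat q :: nat list list \<times> nat list) in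
    if n \<in> pulled_diagram L M ((!) (last_block ps)) then 1 else 0)"

lemma turing_le_coded_diagram:
  assumes "stage_code g \<le>\<^sub>T b" and "diagram_code \<le>\<^sub>T b"
  shows "char_fun (atomic_diagram L (coded_copy g)) \<le>\<^sub>T b"
proof -
  have "char_fun (atomic_diagram L (coded_copy g)) =
      (\<lambda>n. diagram_code (prod_encode (stage_code g (Suc n), n)))"
    unfolding char_fun_def atomic_diagram_coded_copy blocks_def diagram_code_def stage_code_def
    by (simp add: case_prod_unfold del: stage.simps)
  then show ?thesis
    using turing_le_compose[OF assms(2) turing_le_pair[OF turing_le_compose[OF assms(1) turing_le_Suc]
        turing_le_id]] by simp
qed

text \<open>Whether \<open>i\<close> is settled can be read off the first \<open>i + 1\<close>
  values of the characteristic function of the coded set, here the list \<open>cl\<close>;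
  \<open>i < length cl\<close> makes them available.\<close>

definition iso_test :: "nat \<Rightarrow> nat" where
  "iso_test w = (let (a, x) = prod_decode w; (c, q) = prod_decode a;
    (ps, S) = (from_nat q :: nat list list \<times> nat list); cl = rev (list_decode c) in
    if \<exists>i<length ps. i < length cl \<and> (\<forall>j\<le>i. cl ! j = 1 \<longrightarrow> j \<in> set S) \<and> h x \<in> set (ps ! i)
    then 0 else 1)"

definition iso_value :: "nat \<Rightarrow> nat" where
  "iso_value w = (let (a, x) = prod_decode w; (c, q) = prod_decode a;
    (ps, S) = (from_nat q :: nat list list \<times> nat list) in
    SOME y. y < length (last_block ps) \<and> last_block ps ! y = h x)"

lemma iso_test_iff:
  "iso_test (prod_encode (prod_encode (hist (char_fun (range g)) s, stage_code g s), x)) = 0 \<longleftrightarrow>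
    (\<exists>i<s. settled g s i \<and> h x \<in> set (blocks g s ! i))"
proof -
  define seen where "seen i \<longleftrightarrow>
    (\<forall>j\<le>i. map (char_fun (range g)) [0..<s] ! j = 1 \<longrightarrow> j \<in> set (snd (stage g s)))" for i
  have seen: "seen i \<longleftrightarrow> (\<forall>j\<le>i. j \<in> range g \<longrightarrow> j \<in> g ` {..<s})" if "i < s" for i
    using that by (auto simp: seen_def char_fun_def set_snd_stage)
  have "iso_test (prod_encode (prod_encode (hist (char_fun (range g)) s, stage_code g s), x)) = 0 \<longleftrightarrow>
      (\<exists>i<length (fst (stage g s)). i < s \<and> seen i \<and> h x \<in> set (fst (stage g s) ! i))"
    by (simp add: iso_test_def stage_code_def case_prod_unfold Let_def seen_def)
  also have "\<dots> \<longleftrightarrow> (\<exists>i<s. settled g s i \<and> h x \<in> set (blocks g s ! i))"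
    unfolding settled_def blocks_def using seen by blast
  finally show ?thesis .
qed

text \<open>Block \<open>h x\<close> contains \<open>h x\<close>, so the search succeeds at late
  stages. In a settled block the position of \<open>h x\<close> is final, hence it is the preimage
  of \<open>h x\<close> under \<open>limit g\<close>.\<close>

lemma turing_le_coded_iso:
  assumes "stage_code g \<le>\<^sub>T b" and "char_fun (range g) \<le>\<^sub>T b"
    and "iso_test \<le>\<^sub>T b" and "iso_value \<le>\<^sub>T b"
  shows "(\<lambda>x. inv (limit g) (h x)) \<le>\<^sub>T b"
proof -
  let ?D = "\<lambda>s. prod_encode (hist (char_fun (range g)) s, stage_code g s)"
  have ex: "\<exists>s. iso_test (prod_encode (?D s, x)) = 0" for x
  proof -
    obtain s where s: "settled g s (h x)" using settled_exists by blast
    let ?t = "max s (Suc (h x))"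
    have t: "settled g ?t (h x)" using settled_le[OF s, of ?t] by simp
    then have "h x \<in> set (blocks g ?t ! h x)"
      using wf_blocks[of g ?t] by (auto simp: settled_def wf_state_def)
    then have "iso_test (prod_encode (?D ?t, x)) = 0"
      unfolding iso_test_iff using t by (meson lessI less_max_iff_disj)
    then show ?thesis by blast
  qed
  have "iso_value (prod_encode (?D (least_stage ?D iso_test x), x)) = inv (limit g) (h x)" for x
  proof -
    define s where "s = least_stage ?D iso_test x"
    obtain i where i: "settled g s i" "h x \<in> set (blocks g s ! i)"
      using least_stage[where P = iso_test and D = ?D, OF ex[of x]] unfolding iso_test_iff s_def by blast
    then obtain y where y: "y < length (blocks g s ! i)" "blocks g s ! i ! y = h x"
      by (auto simp: in_set_conv_nth)
    have pre: "prefix (blocks g s ! i) (last_block (blocks g s))"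
      using i(1) wf_state_prefix_last_block[OF wf_blocks] by (simp add: settled_def)
    have y': "y < length (last_block (blocks g s))" "last_block (blocks g s) ! y = h x"
      using prefix_length_le[OF pre] prefix_nth[OF pre y(1)] y by auto
    have "(SOME y. y < length (last_block (blocks g s)) \<and> last_block (blocks g s) ! y = h x) = y"
      using y' wf_state_last_block(1)[OF wf_blocks, of g s]
      by (intro some_equality) (metis nth_eq_iff_index_eq)+
    then have "iso_value (prod_encode (?D s, x)) = y"
      by (simp add: iso_value_def stage_code_def case_prod_unfold blocks_def)
    moreover have "inv (limit g) (h x) = y"
      using limit_nth[OF i(1) y(1)] y(2) bij_limit[of g] by (metis bij_is_inj inv_f_f)
    ultimately show ?thesis by (simp add: s_def)
  qed
  then show ?thesis
    using turing_le_search[OF turing_le_pair[OF turing_le_hist[OF assms(2)] assms(1)] assms(3,4) ex]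
    by simp
qed

section \<open>Recovering the coded set from an isomorphism\<close>

definition decode_test :: "nat \<Rightarrow> nat" where
  "decode_test w = (let (a, i) = prod_decode w; (c, q) = prod_decode a;
    (ps, S) = (from_nat q :: nat list list \<times> nat list); fl = rev (list_decode c) in
    if i < length ps \<and> (\<exists>ws. set ws \<subseteq> universe A \<inter> {..<length fl} \<and>
      map ((!) fl) ws = [0..<length (ps ! i)] \<and> same_orbit L M (ps ! i) (map h ws))
    then 0 else 1)"

definition decode_value :: "nat \<Rightarrow> nat" where
  "decode_value w = (let (a, i) = prod_decode w; (c, q) = prod_decode a;
    (ps, S) = (from_nat q :: nat list list \<times> nat list) in if i \<in> set S then 1 else 0)"

text \<open>The list \<open>ws\<close> consists of preimages under \<open>f\<close> of the positions
  of block \<open>i\<close>. Keeping them below \<open>s\<close> makes the history of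
  \<open>f\<close> sufficient, and keeping them in \<open>universe A\<close> excludes meaningless
  values of \<open>f\<close>.\<close>

lemma decode_test_iff:
  "decode_test (prod_encode (prod_encode (hist f s, stage_code g s), i)) = 0 \<longleftrightarrow>
    i < length (blocks g s) \<and> (\<exists>ws. set ws \<subseteq> universe A \<inter> {..<s} \<and>
      map f ws = [0..<length (blocks g s ! i)] \<and> same_orbit L M (blocks g s ! i) (map h ws))"
proof -
  have "map ((!) (map f [0..<s])) ws = map f ws" if "set ws \<subseteq> universe A \<inter> {..<s}" for ws
    using that by auto
  then have "(\<exists>ws. set ws \<subseteq> universe A \<inter> {..<length (map f [0..<s])} \<and>
      map ((!) (map f [0..<s])) ws = us \<and> same_orbit L M vs (map h ws)) \<longleftrightarrow>
      (\<exists>ws. set ws \<subseteq> universe A \<inter> {..<s} \<and> map f ws = us \<and> same_orbit L M vs (map h ws))" for us vs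
    by (metis (no_types, lifting) diff_zero length_map length_upt)
  then show ?thesis
    by (simp add: decode_test_def stage_code_def case_prod_unfold blocks_def Let_def)
qed

text \<open>Both \<open>h\<close> and \<open>limit g \<circ> f\<close> are isomorphisms from
  \<open>A\<close> onto \<open>M\<close>, so they differ by an automorphism of
  \<open>M\<close>.\<close>

lemma same_orbit_limit:
  assumes f: "is_iso L A (coded_copy g) f" and ws: "set ws \<subseteq> universe A" "map f ws = [0..<n]"
  shows "same_orbit L M (map h ws) (map (limit g) [0..<n])"
    and "same_orbit L M (map (limit g) [0..<n]) (map h ws)"
proof -
  let ?h' = "inv_into (universe A) h" and ?f' = "inv_into (universe A) f"
  let ?l' = "inv_into (universe (coded_copy g)) (limit g)"
  have bij: "bij_betw h (universe A) (universe M)" "bij_betw f (universe A) (universe (coded_copy g))"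
    using h f by (simp_all add: is_iso_def)
  have h': "?h' (h w) = w" and f': "?f' (f w) = w" if "w \<in> set ws" for w
    using that ws(1) bij by (auto simp: bij_betw_inv_into_left)
  have l': "?l' (limit g x) = x" for x
    using bij_limit[of g] by (simp add: universe_coded_copy bij_is_inj)
  have "map ((limit g \<circ> f) \<circ> ?h') (map h ws) = map (limit g) (map f ws)"
    using h' by simp
  then show "same_orbit L M (map h ws) (map (limit g) [0..<n])"
    using is_iso_compose[OF is_iso_inv_into[OF A h] is_iso_compose[OF f is_iso_limit]]
    unfolding same_orbit_def ws(2) by blast
  have "map ((h \<circ> ?f') \<circ> ?l') (map (limit g) (map f ws)) = map h ws"
    using f' l' by simp
  then show "same_orbit L M (map (limit g) [0..<n]) (map h ws)"
    using is_iso_compose[OF is_iso_inv_into[OF is_structure_coded_copy is_iso_limit]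
        is_iso_compose[OF is_iso_inv_into[OF A f] h]]
    unfolding same_orbit_def ws(2) by blast
qed

text \<open>A settled block is an initial part of the limit, so by \<open>same_orbit_limit\<close>
  the test succeeds once enough of \<open>f\<close> is known. Conversely, when it succeeds,
  \<open>settled_if_orbit\<close> shows that \<open>i\<close> is in the set only if it has been
  enumerated already.\<close>

lemma turing_le_decode:
  assumes f: "is_iso L A (coded_copy g) f"
    and "stage_code g \<le>\<^sub>T b" and "f \<le>\<^sub>T b" and "decode_test \<le>\<^sub>T b" and "decode_value \<le>\<^sub>T b"
  shows "char_fun (range g) \<le>\<^sub>T b"
proof -
  let ?D = "\<lambda>s. prod_encode (hist f s, stage_code g s)"
  have bij: "bij_betw f (universe A) UNIV"
    using f by (simp add: is_iso_def universe_coded_copy)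
  have ex: "\<exists>s. decode_test (prod_encode (?D s, i)) = 0" for i
  proof -
    obtain s where s: "settled g s i" using settled_exists by blast
    let ?n = "length (blocks g s ! i)"
    define ws where "ws = map (inv_into (universe A) f) [0..<?n]"
    have ws: "set ws \<subseteq> universe A" "map f ws = [0..<?n]"
      using bij by (auto simp: ws_def bij_betw_inv_into_right intro!: map_idI inv_into_into
          dest: bij_betw_imp_surj_on)
    obtain t where t: "set ws \<subseteq> {..<t}" using finite_nat_set_iff_bounded[of "set ws"] by auto
    let ?u = "max s t"
    have u: "settled g ?u i" "blocks g ?u ! i = blocks g s ! i" using settled_le[OF s, of ?u] by auto
    have "same_orbit L M (blocks g ?u ! i) (map h ws)"
      using same_orbit_limit(2)[OF f ws] limit_map[OF s order_refl] u(2) by simp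
    then have "decode_test (prod_encode (?D ?u, i)) = 0"
      unfolding decode_test_iff using u ws t by (intro conjI exI[of _ ws]) (auto simp: settled_def)
    then show ?thesis by blast
  qed
  have "decode_value (prod_encode (?D (least_stage ?D decode_test i), i)) = char_fun (range g) i" for i
  proof -
    define s where "s = least_stage ?D decode_test i"
    obtain ws where i: "i < length (blocks g s)" and ws: "set ws \<subseteq> universe A"
        "map f ws = [0..<length (blocks g s ! i)]" and orb: "same_orbit L M (blocks g s ! i) (map h ws)"
      using least_stage[where P = decode_test and D = ?D, OF ex[of i]]
      unfolding decode_test_iff s_def by blast
    have "settled g s i"
      using settled_if_orbit[OF i same_orbit_trans[OF orb same_orbit_limit(1)[OF f ws]]] .
    then have "i \<in> range g \<longleftrightarrow> i \<in> set (snd (stage g s))"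
      unfolding settled_def set_snd_stage by blast
    then have "decode_value (prod_encode (?D s, i)) = char_fun (range g) i"
      by (simp add: decode_value_def stage_code_def case_prod_unfold char_fun_def)
    then show ?thesis by (simp add: s_def)
  qed
  then have "char_fun (range g) =
      (\<lambda>i. decode_value (prod_encode (?D (least_stage ?D decode_test i), i)))" by auto
  then show ?thesis
    using turing_le_search[OF turing_le_pair[OF turing_le_hist[OF assms(3)] assms(2)] assms(4,5) ex]
    by simp
qed

lemma coding:
  assumes free: "step_code \<le>\<^sub>T b" "diagram_code \<le>\<^sub>T b" "iso_test \<le>\<^sub>T b" "iso_value \<le>\<^sub>T b"
      "decode_test \<le>\<^sub>T b" "decode_value \<le>\<^sub>T b"
    and g: "g \<le>\<^sub>T b" and b: "b \<le>\<^sub>T char_fun (range g)"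
  shows "\<exists>B. computable_copy L A (degree_of b) B \<and>
    (\<exists>f. is_iso L A B f \<and> degree_of f \<le> degree_of (char_fun (range g))) \<and>
    (\<forall>f. is_iso L A B f \<longrightarrow> degree_of (char_fun (range g)) \<le> sup (degree_of f) (degree_of b))"
proof (intro exI[of _ "coded_copy g"] conjI allI impI)
  have st: "stage_code g \<le>\<^sub>T b" by (rule turing_le_stage_code[OF free(1) g])
  show "computable_copy L A (degree_of b) (coded_copy g)"
    unfolding computable_copy_def degree_of_le_iff
    using is_structure_coded_copy universe_coded_copy is_iso_coded_copy
      turing_le_coded_diagram[OF st free(2)] by blast
  \<comment> \<open>The coded set lies above \<open>b\<close>, so it can also run the
    construction.\<close>
  have "(\<lambda>x. inv (limit g) (h x)) \<le>\<^sub>T char_fun (range g)"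
    by (intro turing_le_coded_iso turing_le_refl turing_le_trans[OF _ b] st free)
  then show "\<exists>f. is_iso L A (coded_copy g) f \<and> degree_of f \<le> degree_of (char_fun (range g))"
    using is_iso_coded_copy degree_of_le_iff by blast
next
  fix f assume f: "is_iso L A (coded_copy g) f"
  obtain b' where b': "sup (degree_of f) (degree_of b) = degree_of b'" by (rule degree_of_surj)
  have le: "f \<le>\<^sub>T b'" "b \<le>\<^sub>T b'" by (simp_all flip: degree_of_le_iff b')
  have "char_fun (range g) \<le>\<^sub>T b'"
    using turing_le_stage_code[OF free(1) g] free(5,6)
    by (intro turing_le_decode[OF f _ le(1)] turing_le_trans[OF _ le(2)])
  then show "degree_of (char_fun (range g)) \<le> sup (degree_of f) (degree_of b)"
    by (simp add: b' degree_of_le_iff)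
qed

end

section \<open>C.e. degrees as degrees of ranges, and the theorem\<close>

lemma ce_in_and_above_range:
  assumes "ce_in_and_above c d"
  obtains g where "degree_of g \<le> d" and "c = degree_of (char_fun (range g))"
proof -
  obtain X where c: "c = degree_of (char_fun X)" and X: "ce_in X d"
    using assms by (auto simp: ce_in_and_above_def)
  obtain b where b: "d = degree_of b" by (rule degree_of_surj)
  show thesis
  proof (cases "X = {}")
    \<comment> \<open>The empty set is not a range; it is replaced by the set of all numbers, which
      has the same degree.\<close>
    case True
    have "char_fun X = (\<lambda>x. 0)" "char_fun (range (\<lambda>x. x)) = (\<lambda>x. 1)"
      using True by (auto simp: char_fun_def)
    then have "c = degree_of (char_fun (range (\<lambda>x. x)))"
      unfolding c by (intro order.antisym) (simp_all only: degree_of_le_iff turing_le_const)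
    then show thesis using that[of "\<lambda>x. x"] turing_le_id[of b] by (simp add: b degree_of_le_iff)
  next
    case False
    then show thesis using X c that unfolding ce_in_def by blast
  qed
qed

theorem theorem4p6:
  fixes L :: language and A :: model
  assumes "is_structure L A"
    and "\<forall>e. \<not> comp_categorical_on_cone L A e"
  shows "\<exists>e. \<forall>d\<ge>e. \<forall>c. ce_in_and_above c d \<longrightarrow>
    (\<exists>B. computable_copy L A d B \<and>
      (\<exists>f. is_iso L A B f \<and> degree_of f \<le> c) \<and>
      (\<forall>f. is_iso L A B f \<longrightarrow> c \<le> sup (degree_of f) d))"
proof -
  \<comment> \<open>Failure of categoricity provides two copies, and one of them serves as
    \<open>M\<close>. A finite structure has no copy on all of the natural numbers, so it is
    vacuously categorical and does not arise here.\<close>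
  obtain c0 M where "computable_copy L A c0 M"
    using assms(2) unfolding comp_categorical_on_cone_def by blast
  then obtain h where M: "is_structure L M" "universe M = UNIV" "is_iso L A M h"
    unfolding computable_copy_def by blast
  have "dense_free L M"
    using not_dense_free_categorical[OF assms(1) M] assms(2) by blast
  then interpret coding L M A h using assms(1) M by unfold_locales
  \<comment> \<open>These functions depend on \<open>L\<close>, \<open>A\<close>, \<open>M\<close>
    and \<open>h\<close> but not on the degrees \<open>c\<close> and \<open>d\<close>, so one
    \<open>?e\<close> serves them all.\<close>
  let ?e = "sup (sup (degree_of step_code) (degree_of diagram_code))
    (sup (sup (degree_of iso_test) (degree_of iso_value))
      (sup (degree_of decode_test) (degree_of decode_value)))"
  show ?thesis
  proof (intro exI[of _ ?e] allI impI)
    fix d c assume d: "?e \<le> d" and c: "ce_in_and_above c d"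
    obtain g where g: "degree_of g \<le> d" "c = degree_of (char_fun (range g))"
      using ce_in_and_above_range[OF c] by blast
    obtain b where b: "d = degree_of b" by (rule degree_of_surj)
    have "d \<le> c" using c by (simp add: ce_in_and_above_def)
    then show "\<exists>B. computable_copy L A d B \<and> (\<exists>f. is_iso L A B f \<and> degree_of f \<le> c) \<and>
        (\<forall>f. is_iso L A B f \<longrightarrow> c \<le> sup (degree_of f) d)"
      using d g coding[of b g] by (simp add: b degree_of_le_iff)
  qed
qed

end
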